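(* The following bounds hold for the packing waste $W$ and the shapes $T_1,T_2,T_3$ of Types 1, 2, 3 with parameter $x$ defined in the context. (i) Let $c\le 7$ be a constant. For every $x>0$ and every $x'$ with $x^{3/4}\le x'\le cx$, the Type 1 rectangle $T_1$ of length $x$ and width $x'$ satisfies $$W(T_1)\le \bigl((15+c)\sqrt{2}+38\bigr)x^{5/8}.$$ (ii) For every choice of functions $x'=x'(x)\sim 2x^{1/2}$ and $\theta=\theta(x)$ with $0<\theta<\sqrt{2}\,x^{-1/2}$, for all sufficiently large $x$ the corresponding Type 2 trapezoid $T_2$ satisfies $$W(T_2)\le \Bigl(\tfrac{19}{2}+\tfrac{7}{2}\sqrt{2}\Bigr)x^{5/6}.$$ (iii) For every choice of functions $h=h(x)\sim\frac12 x^{1/2}$ and $\theta=\theta(x)$ with $0<\theta<\sqrt{2}\,x^{-1/2}$, for all sufficiently large $x$ the corresponding Type 3 trapezoid $T_3$ satisfies $$W(T_3)\le \Bigl(\tfrac{19}{4}+\tfrac{7}{4}\sqrt{2}\Bigr)x^{1/3}.$$ In particular, when $T_1$ is a square of side length $x$ (writing $W(x)$ for $W(T_1)$), $$W(x)\le (16\sqrt{2}+38)\,x^{5/8}.$$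
   Context: For a closed planar region $A$, let $S(A)$ be its area. The packing waste is $$W(A)=S(A)-\sup S(A_\lambda),$$ where the supremum is over all sets $A_\lambda\subset A$ that are unions of finitely many (possibly zero) non-overlapping unit squares. Unit squares are squares of side length $1$, allowed in any position and orientation; non-overlapping means having pairwise disjoint interiors. For a square of side length $x$, $W(A)$ is denoted $W(x)$. The notation $f(x)\sim g(x)$ means $f(x)/g(x)\to 1$ as $x\to\infty$. Shapes with parameter $x$: Type 1: a rectangle $T_1$ of length $x$ and width $x'$, where $x^{3/4}\le x'\le cx$ with $c\le 7$ a constant. Type 2: a right trapezoid $T_2$ of height $x$ with horizontal parallel top and bottom edges, vertical left side, top edge of length $x'\sim 2x^{1/2}$, and right-hand side making an angle $\theta$ with the vertical, $0<\theta<\sqrt{2}\,x^{-1/2}$, the trapezoid widening downwards (so the bottom edge has length $x'+x\tan\theta$). Type 3: a right trapezoid $T_3$ of height $h\sim\frac12x^{1/2}$ with horizontal parallel top and bottom edges, vertical left side, top edge of integer length $a=\lfloor x^{1/3}+\sqrt{2}\,x^{1/6}\rfloor$, and right-hand side making an angle $\theta$ with the vertical, $0<\theta<\sqrt{2}\,x^{-1/2}$, the trapezoid widening downwards (so the bottom edge has length $a+h\tan\theta$). *)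

theory Defs
  imports "HOL-Analysis.Analysis" "HOL-Library.Landau_Symbols"
begin

(* The closed rectangle with corner p whose sides of length l and w point in the directions
   t and t + pi/2 (angles measured from the horizontal axis). *)
definition rectangle :: "real^2 \<Rightarrow> real \<Rightarrow> real \<Rightarrow> real \<Rightarrow> (real^2) set" where
  "rectangle p t l w =
     {p + s *\<^sub>R vector [cos t, sin t] + r *\<^sub>R vector [- sin t, cos t] | s r.
        0 \<le> s \<and> s \<le> l \<and> 0 \<le> r \<and> r \<le> w}"

definition unit_square :: "(real^2) set \<Rightarrow> bool" where
  "unit_square Q \<longleftrightarrow> (\<exists>p t. Q = rectangle p t 1 1)"

(* The closed right trapezoid with lower left corner p, vertical left side of length h, horizontal
   top edge of length a, and right side at angle \<theta> from the vertical, widening downwards;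
   at height v above the bottom edge its horizontal width is a + (h - v) tan \<theta>. *)
definition right_trapezoid :: "real^2 \<Rightarrow> real \<Rightarrow> real \<Rightarrow> real \<Rightarrow> (real^2) set" where
  "right_trapezoid p a h \<theta> =
     {p + vector [u, v] | u v. 0 \<le> v \<and> v \<le> h \<and> 0 \<le> u \<and> u \<le> a + (h - v) * tan \<theta>}"

definition square_packing :: "(real^2) set set \<Rightarrow> (real^2) set \<Rightarrow> bool" where
  "square_packing \<Q> A \<longleftrightarrow>
     finite \<Q> \<and> (\<forall>Q\<in>\<Q>. unit_square Q) \<and>
     pairwise (\<lambda>P Q. interior P \<inter> interior Q = {}) \<Q> \<and> \<Union>\<Q> \<subseteq> A"

abbreviation area :: "(real^2) set \<Rightarrow> real" where
  "area A \<equiv> measure lebesgue A"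

(* Meaningful for closed regions A of finite area. The set of packed areas then contains 0 (the
   empty packing) and is bounded by the area of A, so the supremum of reals is the true one. *)
definition packing_waste :: "(real^2) set \<Rightarrow> real" where
  "packing_waste A = area A - Sup {area (\<Union>\<Q>) | \<Q>. square_packing \<Q> A}"

end

theory Submission
  imports Defs
begin

text \<open>Consider a long horizontal strip whose thickness \<open>w\<close> is not an integer. Filled with upright squares it
would lose an area proportional to its length. Instead it is filled with parallel columns of \<open>N \<ge> w\<close>
squares that lean over by an angle \<open>\<theta>\<close> with \<open>N * cos \<theta> + sin \<theta> = w\<close>. As \<open>\<theta>\<close> is of order \<open>w powr (-1/2)\<close>, a
strip of length \<open>L\<close> loses only \<open>O(L * w powr (-1/2))\<close> along its edges, and two right trapezoids of height \<open>w\<close> with slant \<open>\<theta>\<close>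
are left at its ends (lemma \<open>strip_packing\<close>). A rectangle with sides of order at most \<open>x\<close> is cut into a rectangle
with integer sides and two strips of thickness \<open>w \<approx> x powr (3/4)\<close> (lemma \<open>rectangle_waste\<close>). If the trapezoids can be packed with
waste \<open>O(w powr (5/6))\<close>, then every contribution is \<open>O(x powr (5/8))\<close>.

So everything depends on right trapezoids of height \<open>w\<close> and slant of order \<open>w powr (-1/2)\<close>. They are cut into horizontal
layers of integer height \<open>H \<approx> sqrt w / 2\<close>, across which the width grows by less than 1. A layer is packed
as follows (lemmas \<open>packable_tilted_layer\<close> and \<open>trapezoid_layer\<close>). Upright rows start at the vertical side, rows tilted by a fixed
angle \<open>\<phi>\<close> end at the slanted side, and each tilted row of \<open>n\<close> squares starts where \<open>M - n\<close> upright squares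
end. Such a compound row has length \<open>M + sin \<phi> - n * (1 - cos \<phi>)\<close>. Hence its
length can be adjusted in tiny steps of about \<open>\<phi>\<^sup>2 / 2\<close> by exchanging upright squares for tilted ones, and all tilted rows keep the
same direction. The saw teeth of the tilted rows lose \<open>O(\<phi> * H)\<close>. The two lattices meet in a staircase that
runs through \<open>O(1 / \<phi>\<^sup>2)\<close> columns, and each column loses \<open>O(1)\<close> there, because
its upright squares below and above the tilted rows have to be rounded to an integer number. For \<open>\<phi>\<close> of
order \<open>w powr (-1/6)\<close> the \<open>O(sqrt w)\<close> layers lose \<open>O(w powr (5/6))\<close> together (lemma \<open>trapezoid_packing\<close>). A short
trapezoid of height \<open>x powr (1/2) / 2\<close> is a single layer and loses \<open>O(x powr (1/3))\<close>.

In the explicit estimates \<open>u\<close> is a real number whose sixth power is the height of a tall trapezoid, up to an error of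
at most 1 in the height, so that all main terms become multiples of \<open>u^5\<close>.\<close>

section \<open>Rectangles and rigid motions\<close>

definition motion :: "real^2 \<Rightarrow> real \<Rightarrow> real^2 \<Rightarrow> real^2" where
  "motion q t z = q + vector [cos t * z$1 - sin t * z$2, sin t * z$1 + cos t * z$2]"

abbreviation pt :: "real \<Rightarrow> real \<Rightarrow> real^2" where "pt x y \<equiv> vector [x, y]"

lemma mem_rectangle:
  "z \<in> rectangle p t l w \<longleftrightarrow>
     0 \<le> (z$1 - p$1) * cos t + (z$2 - p$2) * sin t \<and>
     (z$1 - p$1) * cos t + (z$2 - p$2) * sin t \<le> l \<and>
     0 \<le> (z$2 - p$2) * cos t - (z$1 - p$1) * sin t \<and>
     (z$2 - p$2) * cos t - (z$1 - p$1) * sin t \<le> w" (is "?L \<longleftrightarrow> ?R")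
proof
  assume ?L
  then obtain s r where z: "z = p + s *\<^sub>R vector [cos t, sin t] + r *\<^sub>R vector [- sin t, cos t]"
    and b: "0 \<le> s" "s \<le> l" "0 \<le> r" "r \<le> w"
    unfolding rectangle_def by blast
  have d: "z$1 - p$1 = s * cos t - r * sin t" "z$2 - p$2 = s * sin t + r * cos t"
    using z by simp_all
  have "cos t * cos t + sin t * sin t = 1"
    using sin_cos_squared_add3 by simp
  then have "(z$1 - p$1) * cos t + (z$2 - p$2) * sin t = s"
     "(z$2 - p$2) * cos t - (z$1 - p$1) * sin t = r"
    unfolding d by algebra+
  then show ?R using b by simp
next
  assume R: ?R
  define s where "s = (z$1 - p$1) * cos t + (z$2 - p$2) * sin t"
  define r where "r = (z$2 - p$2) * cos t - (z$1 - p$1) * sin t"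
  have e: "cos t * cos t + sin t * sin t = 1"
    using sin_cos_squared_add3 by simp
  have "z$1 = p$1 + s * cos t - r * sin t" "z$2 = p$2 + s * sin t + r * cos t"
    unfolding s_def r_def using e by algebra+
  then have "z = p + s *\<^sub>R vector [cos t, sin t] + r *\<^sub>R vector [- sin t, cos t]"
    by (simp add: vec_eq_iff forall_2)
  then show ?L using R unfolding rectangle_def s_def[symmetric] r_def[symmetric] by blast
qed

lemma mem_right_trapezoid:
  "z \<in> right_trapezoid p a h \<theta> \<longleftrightarrow>
     0 \<le> z$2 - p$2 \<and> z$2 - p$2 \<le> h \<and> 0 \<le> z$1 - p$1 \<and>
     z$1 - p$1 \<le> a + (h - (z$2 - p$2)) * tan \<theta>" (is "?L \<longleftrightarrow> ?R")
proof
  assume ?L then show ?R unfolding right_trapezoid_def by auto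
next
  assume R: ?R
  have "z = p + vector [z$1 - p$1, z$2 - p$2]" by (simp add: vec_eq_iff forall_2)
  with R show ?L unfolding right_trapezoid_def by blast
qed

lemma motion_rectangle:
  "motion q t ` rectangle p t' l w = rectangle (motion q t p) (t' + t) l w"
proof -
  have *: "motion q t (p + s *\<^sub>R vector [cos t', sin t'] + r *\<^sub>R vector [- sin t', cos t'])
     = motion q t p + s *\<^sub>R vector [cos (t' + t), sin (t' + t)]
        + r *\<^sub>R vector [- sin (t' + t), cos (t' + t)]" for s r
    by (simp add: motion_def vec_eq_iff forall_2 cos_add sin_add algebra_simps)
  show ?thesis
  proof (intro equalityI subsetI)
    fix z assume "z \<in> motion q t ` rectangle p t' l w"
    then show "z \<in> rectangle (motion q t p) (t' + t) l w"
      unfolding rectangle_def using * by blast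
  next
    fix z assume "z \<in> rectangle (motion q t p) (t' + t) l w"
    then obtain s r where "z = motion q t (p + s *\<^sub>R vector [cos t', sin t'] + r *\<^sub>R vector [- sin t', cos t'])"
      "0 \<le> s \<and> s \<le> l \<and> 0 \<le> r \<and> r \<le> w"
      unfolding * rectangle_def by blast
    then show "z \<in> motion q t ` rectangle p t' l w"
      unfolding rectangle_def by blast
  qed
qed

lemma linear_rotation:
  "linear (\<lambda>z::real^2. pt (cos t * z$1 - sin t * z$2) (sin t * z$1 + cos t * z$2))"
  by (rule linearI) (simp_all add: vec_eq_iff forall_2 algebra_simps)

lemma orthogonal_rotation:
  "orthogonal_transformation (\<lambda>z::real^2. pt (cos t * z$1 - sin t * z$2) (sin t * z$1 + cos t * z$2))"
proof -
  have e: "cos t * cos t + sin t * sin t = 1"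
    using sin_cos_squared_add3 by simp
  have "pt (cos t * v$1 - sin t * v$2) (sin t * v$1 + cos t * v$2) \<bullet>
        pt (cos t * w$1 - sin t * w$2) (sin t * w$1 + cos t * w$2) = v \<bullet> w" for v w :: "real^2"
    unfolding inner_vec_def sum_2 unfolding inner_real_def vector_2 using e by algebra
  then show ?thesis unfolding orthogonal_transformation_def using linear_rotation by blast
qed

lemma motion_image_eq:
  "motion q t ` A = (+) q ` (\<lambda>z. pt (cos t * z$1 - sin t * z$2) (sin t * z$1 + cos t * z$2)) ` A"
  unfolding motion_def by (auto simp: image_image)

lemma interior_motion: "interior (motion q t ` A) = motion q t ` interior A"
  unfolding motion_image_eq interior_translation
  by (subst interior_injective_linear_image)
     (use linear_rotation orthogonal_transformation_inj[OF orthogonal_rotation] in auto)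

lemma inj_motion: "inj (motion q t)"
proof -
  have "motion q t = (+) q \<circ> (\<lambda>z. pt (cos t * z$1 - sin t * z$2) (sin t * z$1 + cos t * z$2))"
    by (auto simp: motion_def fun_eq_iff)
  then show ?thesis
    by (simp only:) (intro inj_compose orthogonal_transformation_inj[OF orthogonal_rotation], simp)
qed

lemma
  assumes "A \<in> lmeasurable"
  shows lmeasurable_motion: "motion q t ` A \<in> lmeasurable"
    and area_motion: "area (motion q t ` A) = area A"
  unfolding motion_image_eq
  using assms measure_orthogonal_image[OF orthogonal_rotation assms]
    measurable_orthogonal_image[OF orthogonal_rotation assms]
  by (auto simp: measure_translation measurable_translation)

lemma motion_0: "motion p t 0 = p"
  by (simp add: motion_def vec_eq_iff forall_2)

lemma rectangle_eq_motion:
  assumes "0 \<le> l" "0 \<le> w"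
  shows "rectangle p t l w = motion p t ` cbox 0 (pt l w)"
proof -
  have "rectangle 0 0 l w = cbox 0 (pt l w)"
    by (auto simp: mem_rectangle mem_box_cart forall_2)
  then show ?thesis using motion_rectangle[of p t 0 0 l w] by (simp add: motion_0)
qed

lemma
  assumes "0 \<le> l" "0 \<le> w"
  shows lmeasurable_rectangle: "rectangle p t l w \<in> lmeasurable"
    and area_rectangle: "area (rectangle p t l w) = l * w"
proof -
  have "measure lborel (cbox 0 (pt l w)) = l * w"
    using assms by (subst content_cbox_cart) (auto simp: interval_ne_empty_cart forall_2 UNIV_2)
  then show "rectangle p t l w \<in> lmeasurable" "area (rectangle p t l w) = l * w"
    unfolding rectangle_eq_motion[OF assms]
    by (simp_all add: lmeasurable_motion area_motion)
qed

lemma convex_rectangle: "convex (rectangle p t l w)"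
proof -
  have "rectangle p t l w =
      {z. pt (cos t) (sin t) \<bullet> z \<ge> pt (cos t) (sin t) \<bullet> p} \<inter>
      {z. pt (cos t) (sin t) \<bullet> z \<le> pt (cos t) (sin t) \<bullet> p + l} \<inter>
      {z. pt (- sin t) (cos t) \<bullet> z \<ge> pt (- sin t) (cos t) \<bullet> p} \<inter>
      {z. pt (- sin t) (cos t) \<bullet> z \<le> pt (- sin t) (cos t) \<bullet> p + w}"
    by (auto simp: mem_rectangle inner_vec_def sum_2 algebra_simps)
  then show ?thesis
    by (metis convex_Int convex_halfspace_le convex_halfspace_ge)
qed

section \<open>Counting squares of packings\<close>

text \<open>Counting squares instead of measuring their union makes lower bounds additive over
  pieces with disjoint interiors. The bound is real-valued, so that it can be written as an area minus an
  explicit loss. Nothing is given away, since a packing covers an area equal to its cardinality.\<close>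
definition packable :: "(real^2) set \<Rightarrow> real \<Rightarrow> bool" where
  "packable A r \<longleftrightarrow> (\<exists>\<Q>. square_packing \<Q> A \<and> r \<le> real (card \<Q>))"

lemma packable_motion:
  assumes "packable A r"
  shows "packable (motion q t ` A) r"
proof -
  obtain \<Q> where Q: "square_packing \<Q> A" and r: "r \<le> card \<Q>"
    using assms unfolding packable_def by blast
  let ?g = "\<lambda>S. motion q t ` S"
  have "unit_square (?g S)" if "unit_square S" for S
    using that unfolding unit_square_def by (metis motion_rectangle)
  moreover have "pairwise (\<lambda>P Q. interior P \<inter> interior Q = {}) (?g ` \<Q>)"
  proof (rule pairwiseI)
    fix P R assume "P \<in> ?g ` \<Q>" "R \<in> ?g ` \<Q>" "P \<noteq> R"
    then obtain P' R' where *: "P' \<in> \<Q>" "R' \<in> \<Q>" "P = ?g P'" "R = ?g R'" "P' \<noteq> R'" by auto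
    then have "interior P' \<inter> interior R' = {}"
      using Q unfolding square_packing_def pairwise_def by blast
    then show "interior P \<inter> interior R = {}"
      unfolding *(3,4) interior_motion using inj_motion by (auto dest: injD)
  qed
  ultimately have "square_packing (?g ` \<Q>) (?g A)"
    using Q unfolding square_packing_def by blast
  moreover have "card (?g ` \<Q>) = card \<Q>"
    by (intro card_image inj_onI) (metis inj_motion inj_image_eq_iff)
  ultimately show ?thesis unfolding packable_def using r by metis
qed

text \<open>Common points of the two sets lie on a frontier, and the frontier of a convex set is a null set.\<close>
lemma interior_disjoint_imp_negligible_Int:
  fixes S T :: "(real^2) set"
  assumes "convex S" "convex T" "interior S \<inter> interior T = {}"
  shows "negligible (S \<inter> T)"
proof (rule negligible_subset)
  show "negligible (frontier S \<union> frontier T)"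
    using assms negligible_convex_frontier by auto
  show "S \<inter> T \<subseteq> frontier S \<union> frontier T"
    using assms(3) closure_subset unfolding frontier_def by blast
qed

lemma area_Union_packing:
  assumes "square_packing \<Q> A"
  shows "\<Union>\<Q> \<in> lmeasurable" "area (\<Union>\<Q>) = card \<Q>"
proof -
  have Q: "S \<in> lmeasurable \<and> area S = 1 \<and> convex S" if "S \<in> \<Q>" for S
  proof -
    obtain p t where "S = rectangle p t 1 1"
      using \<open>S \<in> \<Q>\<close> assms unfolding square_packing_def unit_square_def by blast
    then show ?thesis
      using lmeasurable_rectangle[of 1 1] area_rectangle[of 1 1] convex_rectangle by simp
  qed
  have fin: "finite \<Q>" using assms by (auto simp: square_packing_def)
  have "\<Q> \<subseteq> lmeasurable" using Q by blast
  with fin show "\<Union>\<Q> \<in> lmeasurable" by (rule fmeasurable.finite_Union)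
  have "area (\<Union>\<Q>) = (\<Sum>S\<in>\<Q>. area S)"
  proof (rule measure_negligible_finite_Union[OF fin])
    show "pairwise (\<lambda>S T. negligible (S \<inter> T)) \<Q>"
    proof (rule pairwiseI)
      fix S T assume "S \<in> \<Q>" "T \<in> \<Q>" "S \<noteq> T"
      moreover from this have "interior S \<inter> interior T = {}"
        using assms unfolding square_packing_def pairwise_def by blast
      ultimately show "negligible (S \<inter> T)"
        using Q interior_disjoint_imp_negligible_Int by blast
    qed
  qed (use Q in blast)
  then show "area (\<Union>\<Q>) = card \<Q>" using Q by simp
qed

lemma packing_waste_le:
  assumes "packable A r" "A \<in> lmeasurable"
  shows "packing_waste A \<le> area A - r"
proof -
  let ?X = "{area (\<Union>\<Q>) | \<Q>. square_packing \<Q> A}"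
  obtain \<Q> where Q: "square_packing \<Q> A" "r \<le> card \<Q>"
    using assms unfolding packable_def by blast
  have "bdd_above ?X"
  proof (rule bdd_aboveI)
    fix y assume "y \<in> ?X"
    then obtain \<R> where R: "square_packing \<R> A" "y = area (\<Union>\<R>)" by blast
    show "y \<le> area A"
      unfolding R(2) by (rule measure_mono_fmeasurable)
        (use R area_Union_packing assms in \<open>auto simp: square_packing_def\<close>)
  qed
  then have "area (\<Union>\<Q>) \<le> Sup ?X" by (intro cSup_upper) (use Q in auto)
  then show ?thesis
    unfolding packing_waste_def using Q area_Union_packing[OF Q(1)] by simp
qed

lemma packable_empty: "r \<le> 0 \<Longrightarrow> packable A r"
  unfolding packable_def square_packing_def by (rule exI[of _ "{}"]) auto

lemma interior_unit_square: "unit_square S \<Longrightarrow> interior S \<noteq> {}"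
proof -
  assume "unit_square S"
  then obtain p t where S: "S = rectangle p t 1 1" unfolding unit_square_def by blast
  have "S = motion p t ` cbox 0 (pt 1 1)" unfolding S by (rule rectangle_eq_motion) auto
  moreover have "pt (1/2) (1/2) \<in> box 0 (pt 1 1)" by (simp add: mem_box_cart forall_2)
  ultimately show ?thesis by (auto simp: interior_motion)
qed

text \<open>Squares chosen from different pieces are different squares, because a unit square has interior
  points; hence the cardinalities add up.\<close>
lemma packable_family:
  assumes fin: "finite I"
    and pack: "\<And>i. i \<in> I \<Longrightarrow> packable (A i) (r i)"
    and sub: "\<And>i. i \<in> I \<Longrightarrow> A i \<subseteq> C"
    and disj: "\<And>i j. i \<in> I \<Longrightarrow> j \<in> I \<Longrightarrow> i \<noteq> j \<Longrightarrow> interior (A i) \<inter> interior (A j) = {}"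
  shows "packable C (\<Sum>i\<in>I. r i)"
proof -
  have "\<forall>i\<in>I. \<exists>\<Q>. square_packing \<Q> (A i) \<and> r i \<le> card \<Q>"
    using pack unfolding packable_def by blast
  then obtain F where F: "\<And>i. i \<in> I \<Longrightarrow> square_packing (F i) (A i)"
    "\<And>i. i \<in> I \<Longrightarrow> r i \<le> card (F i)" by metis
  have int: "interior S \<subseteq> interior (A i)" if "i \<in> I" "S \<in> F i" for i S
    using F(1)[OF that(1)] that(2) by (intro interior_mono) (auto simp: square_packing_def)
  have ne: "interior S \<noteq> {}" if "i \<in> I" "S \<in> F i" for i S
    using F(1)[OF that(1)] that(2) interior_unit_square by (auto simp: square_packing_def)
  have "square_packing (\<Union>i\<in>I. F i) C"
    unfolding square_packing_def
  proof (intro conjI)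
    show "finite (\<Union>i\<in>I. F i)" using fin F by (auto simp: square_packing_def)
    show "\<forall>Q\<in>\<Union> (F ` I). unit_square Q" using F by (auto simp: square_packing_def)
    show "\<Union> (\<Union> (F ` I)) \<subseteq> C" using F sub by (fastforce simp: square_packing_def)
    show "pairwise (\<lambda>P Q. interior P \<inter> interior Q = {}) (\<Union> (F ` I))"
    proof (rule pairwiseI)
      fix P Q assume "P \<in> \<Union> (F ` I)" "Q \<in> \<Union> (F ` I)" "P \<noteq> Q"
      then obtain i j where ij: "i \<in> I" "j \<in> I" "P \<in> F i" "Q \<in> F j" by blast
      show "interior P \<inter> interior Q = {}"
      proof (cases "i = j")
        case True
        then show ?thesis using F(1)[OF ij(1)] ij \<open>P \<noteq> Q\<close>
          unfolding square_packing_def pairwise_def by blast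
      next
        case False
        then show ?thesis using disj[OF ij(1,2)] int ij by blast
      qed
    qed
  qed
  moreover have "card (\<Union>i\<in>I. F i) = (\<Sum>i\<in>I. card (F i))"
  proof (rule card_UN_disjoint[OF fin])
    show "\<forall>i\<in>I. finite (F i)" using F by (auto simp: square_packing_def)
    show "\<forall>i\<in>I. \<forall>j\<in>I. i \<noteq> j \<longrightarrow> F i \<inter> F j = {}"
    proof (intro ballI impI)
      fix i j assume ij: "i \<in> I" "j \<in> I" "i \<noteq> j"
      then show "F i \<inter> F j = {}"
        using int[of i] int[of j] ne[of i] disj[OF ij] by blast
    qed
  qed
  moreover have "(\<Sum>i\<in>I. r i) \<le> (\<Sum>i\<in>I. real (card (F i)))"
    by (rule sum_mono) (use F in auto)
  ultimately show ?thesis unfolding packable_def by (intro exI conjI) auto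
qed

text \<open>The only source of disjointness below: two pieces lie on different sides of a line.\<close>
lemma interiors_separated:
  fixes A B :: "(real^2) set"
  assumes "\<And>z. z \<in> A \<Longrightarrow> \<alpha> * z$1 + \<beta> * z$2 \<le> \<gamma>"
    and "\<And>z. z \<in> B \<Longrightarrow> \<gamma> \<le> \<alpha> * z$1 + \<beta> * z$2"
    and "\<alpha> \<noteq> 0 \<or> \<beta> \<noteq> 0"
  shows "interior A \<inter> interior B = {}"
proof -
  let ?n = "pt \<alpha> \<beta>"
  have n: "?n \<noteq> 0" using assms(3) by (auto simp: vec_eq_iff forall_2)
  have "A \<subseteq> {z. ?n \<bullet> z \<le> \<gamma>}" "B \<subseteq> {z. ?n \<bullet> z \<ge> \<gamma>}"
    using assms(1,2) by (auto simp: inner_vec_def sum_2)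
  then have "interior A \<subseteq> {z. ?n \<bullet> z < \<gamma>}" "interior B \<subseteq> {z. ?n \<bullet> z > \<gamma>}"
    using interior_mono interior_halfspace_le[OF n] interior_halfspace_ge[OF n] by metis+
  then show ?thesis by force
qed

lemma packable_mono: "packable A r \<Longrightarrow> A \<subseteq> B \<Longrightarrow> r' \<le> r \<Longrightarrow> packable B r'"
  unfolding packable_def square_packing_def by (meson order_trans)

lemma packable_union:
  assumes "packable A r" "packable B s" "A \<subseteq> C" "B \<subseteq> C" "interior A \<inter> interior B = {}"
  shows "packable C (r + s)"
proof -
  have "packable C (\<Sum>i\<in>{True,False}. if i then r else s)"
    by (rule packable_family[where A = "\<lambda>i. if i then A else B"]) (use assms in auto)
  then show ?thesis by simp
qed

lemma packable_grid: "packable (rectangle p t (real m) (real n)) (real m * real n)"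
proof -
  let ?sq = "\<lambda>(i, j). motion p t ` rectangle (pt (real i) (real j)) 0 1 1"
  have "packable (rectangle p t (real m) (real n)) (\<Sum>ij\<in>{..<m}\<times>{..<n}. 1)"
  proof (rule packable_family[where A = ?sq])
    fix ij assume ij: "ij \<in> {..<m}\<times>{..<n}"
    then obtain i j where [simp]: "ij = (i,j)" and *: "i < m" "j < n" by auto
    have "square_packing {?sq ij} (?sq ij)"
      by (auto simp: square_packing_def unit_square_def motion_rectangle)
    then show "packable (?sq ij) 1" unfolding packable_def by force
    have "real i + 1 \<le> real m" "real j + 1 \<le> real n" using * by linarith+
    then have "rectangle (pt (real i) (real j)) 0 1 1 \<subseteq> rectangle 0 0 (real m) (real n)"
      by (auto simp: mem_rectangle)
    then have "?sq ij \<subseteq> motion p t ` rectangle 0 0 (real m) (real n)" by auto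
    then show "?sq ij \<subseteq> rectangle p t (real m) (real n)"
      unfolding motion_rectangle by (simp add: motion_0)
  next
    fix ij kl assume "ij \<noteq> (kl :: nat \<times> nat)"
    obtain i j k l where [simp]: "ij = (i,j)" "kl = (k,l)" by (meson surj_pair)
    have "i < k \<or> k < i \<or> j < l \<or> l < j" using \<open>ij \<noteq> kl\<close> by auto
    then have c: "real i + 1 \<le> real k \<or> real k + 1 \<le> real i \<or> real j + 1 \<le> real l \<or> real l + 1 \<le> real j"
      by linarith
    have "interior (rectangle (pt (real i) (real j)) 0 1 1) \<inter> interior (rectangle (pt (real k) (real l)) 0 1 1) = {}"
      using c
    proof (elim disjE)
      assume "real i + 1 \<le> real k"
      then show ?thesis by (intro interiors_separated[where \<alpha>=1 and \<beta>=0 and \<gamma>="real k"]) (auto simp: mem_rectangle)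
    next
      assume "real k + 1 \<le> real i"
      then show ?thesis by (intro interiors_separated[where \<alpha>="-1" and \<beta>=0 and \<gamma>="-real i"]) (auto simp: mem_rectangle)
    next
      assume "real j + 1 \<le> real l"
      then show ?thesis by (intro interiors_separated[where \<alpha>=0 and \<beta>=1 and \<gamma>="real l"]) (auto simp: mem_rectangle)
    next
      assume "real l + 1 \<le> real j"
      then show ?thesis by (intro interiors_separated[where \<alpha>=0 and \<beta>="-1" and \<gamma>="-real j"]) (auto simp: mem_rectangle)
    qed
    then show "interior (?sq ij) \<inter> interior (?sq kl) = {}"
      using inj_motion by (auto simp: interior_motion dest: injD)
  qed simp
  then show ?thesis by simp
qed

lemma packable_rectangle_grid:
  assumes "real m \<le> l" "real n \<le> w"
  shows "packable (rectangle p t l w) (real m * real n)"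
proof (rule packable_mono[OF packable_grid])
  show "rectangle p t (real m) (real n) \<subseteq> rectangle p t l w"
  proof
    fix z assume "z \<in> rectangle p t (real m) (real n)"
    then show "z \<in> rectangle p t l w" using assms unfolding mem_rectangle by auto
  qed
qed simp

section \<open>Right trapezoids\<close>

lemma right_trapezoid_eq_motion: "right_trapezoid p a h \<theta> = motion p 0 ` right_trapezoid 0 a h \<theta>"
proof (intro equalityI subsetI)
  fix z assume z: "z \<in> right_trapezoid p a h \<theta>"
  have "z = motion p 0 (z - p)" by (simp add: motion_def vec_eq_iff forall_2)
  moreover have "z - p \<in> right_trapezoid 0 a h \<theta>" using z by (simp add: mem_right_trapezoid)
  ultimately show "z \<in> motion p 0 ` right_trapezoid 0 a h \<theta>" by blast
next
  fix z assume "z \<in> motion p 0 ` right_trapezoid 0 a h \<theta>"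
  then show "z \<in> right_trapezoid p a h \<theta>" by (auto simp: mem_right_trapezoid motion_def)
qed

lemma packable_right_trapezoid_translate:
  "packable (right_trapezoid 0 a h \<theta>) r \<Longrightarrow> packable (right_trapezoid p a h \<theta>) r"
  using packable_motion right_trapezoid_eq_motion by metis

lemma packable_trapezoid_stack:
  assumes "packable (right_trapezoid 0 a h2 \<theta>) r2" "packable (right_trapezoid 0 (a + h2 * tan \<theta>) h1 \<theta>) r1"
    and "0 \<le> h1" "0 \<le> h2"
  shows "packable (right_trapezoid 0 a (h1 + h2) \<theta>) (r1 + r2)"
proof (rule packable_union)
  show "packable (right_trapezoid (pt 0 h1) a h2 \<theta>) r2"
    by (rule packable_right_trapezoid_translate) fact
  show "interior (right_trapezoid 0 (a + h2 * tan \<theta>) h1 \<theta>) \<inter> interior (right_trapezoid (pt 0 h1) a h2 \<theta>) = {}"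
    by (rule interiors_separated[where \<alpha>=0 and \<beta>=1 and \<gamma>=h1]) (auto simp: mem_right_trapezoid)
qed (use assms in \<open>auto simp: mem_right_trapezoid algebra_simps\<close>)

text \<open>An integer number of unwasted columns can be put to the left of any packed trapezoid, so only the
  part near the slanted side has to be treated with care.\<close>
lemma packable_trapezoid_add_rectangle:
  assumes "packable (right_trapezoid 0 a h \<theta>) r" "0 \<le> tan \<theta>" "0 \<le> a" "real H \<le> h"
  shows "packable (right_trapezoid 0 (real k + a) h \<theta>) (real k * real H + r)"
proof (rule packable_union)
  show "packable (rectangle 0 0 (real k) (real H)) (real k * real H)" by (rule packable_grid)
  show "packable (right_trapezoid (pt (real k) 0) a h \<theta>) r"
    by (rule packable_right_trapezoid_translate) fact
  show "interior (rectangle 0 0 (real k) (real H)) \<inter> interior (right_trapezoid (pt (real k) 0) a h \<theta>) = {}"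
    by (rule interiors_separated[where \<alpha>=1 and \<beta>=0 and \<gamma>="real k"]) (auto simp: mem_right_trapezoid mem_rectangle)
  show "rectangle 0 0 (real k) (real H) \<subseteq> right_trapezoid 0 (real k + a) h \<theta>"
  proof
    fix z assume z: "z \<in> rectangle 0 0 (real k) (real H)"
    then have b: "0 \<le> z$1" "z$1 \<le> real k" "0 \<le> z$2" "z$2 \<le> real H"
      by (auto simp: mem_rectangle)
    then have "0 \<le> (h - z$2) * tan \<theta>" using assms by (intro mult_nonneg_nonneg) auto
    then show "z \<in> right_trapezoid 0 (real k + a) h \<theta>"
      unfolding mem_right_trapezoid zero_index diff_zero using b assms(2-) by linarith
  qed
qed (auto simp: mem_right_trapezoid)

lemma packable_trapezoid_grid:
  assumes "real m \<le> a" "real n \<le> h" "0 \<le> tan \<theta>"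
  shows "packable (right_trapezoid 0 a h \<theta>) (real m * real n)"
proof -
  have "rectangle 0 0 (real m) (real n) \<subseteq> right_trapezoid 0 a h \<theta>"
  proof
    fix x assume "x \<in> rectangle 0 0 (real m) (real n)"
    then have *: "0 \<le> x$1" "x$1 \<le> real m" "0 \<le> x$2" "x$2 \<le> real n" by (auto simp: mem_rectangle)
    then have "0 \<le> (h - x$2) * tan \<theta>" using assms by (intro mult_nonneg_nonneg) auto
    then show "x \<in> right_trapezoid 0 a h \<theta>"
      unfolding mem_right_trapezoid zero_index diff_zero using * assms by linarith
  qed
  then show ?thesis using packable_grid packable_mono by blast
qed

lemma floor_grid_waste:
  fixes a b :: real
  assumes "0 \<le> a" "0 \<le> b"
  shows "a * b - (a + b) \<le> real (nat \<lfloor>a\<rfloor>) * real (nat \<lfloor>b\<rfloor>)"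
proof -
  let ?m = "real (nat \<lfloor>a\<rfloor>)" and ?n = "real (nat \<lfloor>b\<rfloor>)"
  have m: "?m \<le> a" "a - 1 \<le> ?m" and n: "?n \<le> b" "b - 1 \<le> ?n" using assms by linarith+
  have "a * (b - ?n) \<le> a * 1" by (rule mult_left_mono) (use n assms in linarith)+
  moreover have "?n * (a - ?m) \<le> ?n * 1" by (rule mult_left_mono) (use m in linarith)+
  ultimately show ?thesis using n(1) unfolding right_diff_distrib mult.commute[of ?n] by linarith
qed

lemma convex_right_trapezoid: "convex (right_trapezoid p a h \<theta>)"
proof -
  have "right_trapezoid p a h \<theta> =
      {z. pt 0 1 \<bullet> z \<ge> p$2} \<inter> {z. pt 0 1 \<bullet> z \<le> p$2 + h} \<inter> {z. pt 1 0 \<bullet> z \<ge> p$1} \<inter>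
      {z. pt 1 (tan \<theta>) \<bullet> z \<le> p$1 + a + (h + p$2) * tan \<theta>}"
    by (auto simp: mem_right_trapezoid inner_vec_def sum_2 algebra_simps)
  then show ?thesis
    by (metis convex_Int convex_halfspace_le convex_halfspace_ge)
qed

text \<open>The trapezoid and its image under a half turn about the midpoint of the slanted side fit together,
  without overlap, inside a rectangle of length \<open>2 * a + h * tan \<theta>\<close>. Only the upper bound for the area
  matters for an upper bound of the waste.\<close>
lemma
  assumes a: "0 \<le> a" and h: "0 \<le> h" and t: "0 \<le> tan \<theta>"
  shows lmeasurable_right_trapezoid: "right_trapezoid p a h \<theta> \<in> lmeasurable"
    and area_right_trapezoid_le: "area (right_trapezoid p a h \<theta>) \<le> a * h + h\<^sup>2 * tan \<theta> / 2"
proof -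
  let ?T = "right_trapezoid 0 a h \<theta>"
  let ?b = "2 * a + h * tan \<theta>"
  let ?T' = "motion (pt ?b h) pi ` ?T"
  have ht: "0 \<le> h * tan \<theta>" using h t by simp
  have sub: "?T \<subseteq> rectangle 0 0 ?b h"
  proof
    fix z assume z: "z \<in> ?T"
    then have "0 \<le> z$2 * tan \<theta>" using t by (auto simp: mem_right_trapezoid)
    then show "z \<in> rectangle 0 0 ?b h"
      using z a ht by (auto simp: mem_right_trapezoid mem_rectangle algebra_simps)
  qed
  have "?T' \<subseteq> motion (pt ?b h) pi ` rectangle 0 0 ?b h" using sub by blast
  also have "\<dots> = rectangle 0 0 ?b h"
  proof -
    have "z \<in> motion (pt ?b h) pi ` rectangle 0 0 ?b h \<longleftrightarrow> z \<in> rectangle 0 0 ?b h" for z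
      unfolding motion_rectangle by (auto simp: mem_rectangle motion_def)
    then show ?thesis by blast
  qed
  finally have sub': "?T' \<subseteq> rectangle 0 0 ?b h" .
  have R: "rectangle 0 0 ?b h \<in> lmeasurable" "area (rectangle 0 0 ?b h) = ?b * h"
    using lmeasurable_rectangle[of ?b h 0 0] area_rectangle[of ?b h 0 0] a h ht by auto
  have cbox: "bounded (rectangle 0 0 ?b h)"
  proof -
    have "rectangle 0 0 ?b h \<subseteq> cbox 0 (pt ?b h)" by (auto simp: mem_rectangle mem_box_cart forall_2)
    then show ?thesis using bounded_cbox bounded_subset by blast
  qed
  have T: "?T \<in> lmeasurable"
    using sub cbox bounded_subset convex_right_trapezoid by (intro measurable_convex) auto
  then show "right_trapezoid p a h \<theta> \<in> lmeasurable"
    using lmeasurable_motion right_trapezoid_eq_motion by metis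
  have area_eq: "area (right_trapezoid p a h \<theta>) = area ?T"
    using T area_motion right_trapezoid_eq_motion by metis
  have T': "?T' \<in> lmeasurable" "area ?T' = area ?T" using T lmeasurable_motion area_motion by auto
  have "convex ?T'"
  proof -
    have "?T' = (\<lambda>z. pt ?b h - z) ` ?T"
      by (rule image_cong) (auto simp: motion_def vec_eq_iff forall_2)
    then have "?T' = (+) (pt ?b h) ` uminus ` ?T" by (auto simp: image_image)
    then show ?thesis using convex_right_trapezoid convex_negations convex_translation by metis
  qed
  moreover have "interior ?T \<inter> interior ?T' = {}"
    by (rule interiors_separated[where \<alpha>=1 and \<beta>="tan \<theta>" and \<gamma>="a + h * tan \<theta>"])
       (auto simp: mem_right_trapezoid motion_def algebra_simps)
  ultimately have "negligible (?T \<inter> ?T')"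
    using interior_disjoint_imp_negligible_Int convex_right_trapezoid by blast
  then have "area ?T + area ?T' = area (?T \<union> ?T')"
    using measure_Un3[OF T T'(1)] negligible_imp_measure0 by simp
  also have "\<dots> \<le> area (rectangle 0 0 ?b h)"
    using sub sub' R T T' by (intro measure_mono_fmeasurable) auto
  finally show "area (right_trapezoid p a h \<theta>) \<le> a * h + h\<^sup>2 * tan \<theta> / 2"
    using T' R area_eq by (simp add: algebra_simps power2_eq_square)
qed

section \<open>Layers with tilted rows\<close>

text \<open>Double counting: the squares of rows of lengths \<open>n k\<close>, arranged flush at one end, are counted
  column by column.\<close>
lemma sum_count_above:
  fixes n :: "nat \<Rightarrow> nat"
  assumes "\<And>k. k < K \<Longrightarrow> n k \<le> M"
  shows "(\<Sum>k<K. n k) = (\<Sum>i<M. card {k. k < K \<and> i < n k})"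
proof -
  have "(\<Sum>k<K. n k) = (\<Sum>k<K. \<Sum>i<M. if i < n k then 1 else 0)"
  proof (rule sum.cong)
    fix k assume "k \<in> {..<K}"
    then have "{i. i < M \<and> i < n k} = {..<n k}" using assms[of k] by auto
    then show "n k = (\<Sum>i<M. if i < n k then 1 else 0)"
      by (simp add: sum.If_cases Int_def)
  qed simp
  also have "\<dots> = (\<Sum>i<M. \<Sum>k<K. if i < n k then 1 else 0)" by (rule sum.swap)
  also have "\<dots> = (\<Sum>i<M. card {k. k < K \<and> i < n k})"
    by (simp add: sum.If_cases Int_def)
  finally show ?thesis .
qed

text \<open>With lengths that increase upwards, the rows that reach into a given column are the topmost ones.\<close>
lemma above_iff_ge_index:
  fixes n :: "nat \<Rightarrow> nat"
  assumes "mono n" "k < K"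
  shows "i < n k \<longleftrightarrow> K - card {k. k < K \<and> i < n k} \<le> k"
proof -
  obtain m where m: "m \<le> K" "\<And>k. k < K \<Longrightarrow> i < n k \<longleftrightarrow> m \<le> k"
  proof (cases "\<exists>k<K. i < n k")
    case True
    then obtain k0 where k0: "k0 < K" "i < n k0" by blast
    define m where "m = (LEAST k. i < n k)"
    have "i < n m" unfolding m_def using k0(2) by (rule LeastI)
    moreover have le: "m \<le> k" if "i < n k" for k unfolding m_def using that by (rule Least_le)
    moreover have "n m \<le> n k" if "m \<le> k" for k using that by (rule monoD[OF assms(1)])
    ultimately have "i < n k \<longleftrightarrow> m \<le> k" for k by (meson order_less_le_trans)
    moreover have "m \<le> K" using le[OF k0(2)] k0(1) by simp
    ultimately show ?thesis using that by blast
  next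
    case False
    then show ?thesis using that[of K] by auto
  qed
  have "{k. k < K \<and> i < n k} = {m..<K}" using m(2) by auto
  then have "K - card {k. k < K \<and> i < n k} = m" using m(1) by simp
  then show ?thesis using m(2)[OF assms(2)] by simp
qed

text \<open>The geometric heart of the construction. Row \<open>k\<close> of the tilted part consists of \<open>n k\<close> squares inclined
  at the angle \<open>\<phi>\<close>; its top left corner has the integer abscissa \<open>M - n k\<close>, and its lower edge lies on a
  line of slope \<open>T\<close> through the point of height \<open>z k\<close> above the abscissa \<open>M + s\<close>. Consecutive lines are at
  distance 1, so the tilted rows are stacked without gaps. The hypothesis \<open>fit\<close> says that the right end of
  the row stays to the left of the slanted side.

  Column \<open>i\<close>, counted from the abscissa \<open>M\<close> to the left, is crossed by the \<open>J i\<close> topmost tilted rows only. Below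
  the lowest of these and above the highest row it is filled with upright unit squares. Rounding down the two
  heights costs at most one square each, which explains the two summands \<open>- 1\<close>. The two columns next to
  the abscissa \<open>M\<close> may stick out of the trapezoid and receive no upright squares.\<close>
lemma packable_tilted_layer:
  fixes n :: "nat \<Rightarrow> nat" and z :: "nat \<Rightarrow> real" and \<phi> \<theta> l z0 :: real and H M K :: nat
  defines "s \<equiv> sin \<phi>" and "c \<equiv> cos \<phi>" and "T \<equiv> tan \<phi>"
  defines "J \<equiv> \<lambda>i. card {k. k < K \<and> i < n k}"
  assumes \<phi>: "0 < \<phi>" "\<phi> < pi / 2"
    and z: "\<And>k. z k = z0 + real k / c"
    and n: "mono n" "\<And>k. k < K \<Longrightarrow> n k \<le> M"
    and zK: "z K \<le> real H" and z0: "(real M + 1) * T \<le> z0"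
    and fit: "\<And>k. k < K \<Longrightarrow> real M + s - real (n k) * (1 - c) \<le> l + (real H - z k) * tan \<theta>"
    and l: "real M \<le> l + 2"
    and \<theta>: "0 \<le> tan \<theta>" "tan \<theta> \<le> T"
  shows "packable (right_trapezoid 0 l (real H) \<theta>)
    ((\<Sum>k<K. real (n k)) + (\<Sum>i=2..<M. (z (K - J i) - (s + real i + 1) * T - 1)
         + (real H - z K + (s + real i) * T - 1)))"
proof -
  have s: "0 < s" "s \<le> 1" and c: "0 < c" "c \<le> 1" and T: "0 < T" and cT: "c * T = s"
    using \<phi> cos_gt_zero[of \<phi>] sin_gt_zero[of \<phi>] tan_gt_zero[of \<phi>]
    by (auto simp: s_def c_def T_def tan_def)
  have sT: "s \<le> T" using cT c T mult_right_mono[of c 1 T] by simp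
  have sc: "c * c + s * s = 1" using sin_cos_squared_add3 by (simp add: s_def c_def)
  define \<tau> where "\<tau> = tan \<theta>"
  have \<tau>: "0 \<le> \<tau>" "c * \<tau> \<le> s" using \<theta> cT c by (auto simp: \<tau>_def)
  have z_mono: "z i \<le> z j" if "i \<le> j" for i j
    using that c by (simp add: z divide_right_mono)
  have cz: "c * z k = c * z0 + real k" for k
    unfolding z distrib_left using c by simp
  define B where "B = (\<lambda>i. nat \<lfloor>z (K - J i) - (s + real i + 1) * T\<rfloor>)"
  define t where "t = (\<lambda>i. nat \<lfloor>real H - z K + (s + real i) * T\<rfloor>)"
  define bar where "bar = (\<lambda>k. rectangle (pt (real M - real (n k) + s) (z k - real (n k) * T)) \<phi> (real (n k)) (real 1))"
  define bot where "bot = (\<lambda>i. rectangle (pt (real M - real i - 1) 0) 0 (real 1) (real (B i)))"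
  define top where "top = (\<lambda>i. rectangle (pt (real M - real i - 1) (real H - real (t i))) 0 (real 1) (real (t i)))"
  define e where "e = c * z0 - s * (real M + s)"
  let ?T = "right_trapezoid 0 l (real H) \<theta>"
  have iT: "(s + real i + 1) * T \<le> z k" if "i < M" for i k
  proof -
    have "(s + real i + 1) * T \<le> (real M + 1) * T"
      using that s T by (intro mult_right_mono) auto
    then show ?thesis using z0 z_mono[of 0 k] z[of 0] by simp
  qed
  have B: "z (K - J i) - (s + real i + 1) * T - 1 \<le> real (B i)"
    "real (B i) \<le> z (K - J i) - (s + real i + 1) * T" if "i < M" for i
    using iT[OF that, of "K - J i"] unfolding B_def by linarith+
  have t: "real H - z K + (s + real i) * T - 1 \<le> real (t i)"
    "real (t i) \<le> real H - z K + (s + real i) * T" for i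
  proof -
    have "0 \<le> real H - z K + (s + real i) * T" using zK s T by simp
    then show "real H - z K + (s + real i) * T - 1 \<le> real (t i)"
      "real (t i) \<le> real H - z K + (s + real i) * T" unfolding t_def by linarith+
  qed
  have tH: "real (t i) \<le> real H" if "i < M" for i
  proof -
    have "(s + real i) * T \<le> (s + real i + 1) * T" using T by (intro mult_right_mono) auto
    then show ?thesis using t(2)[of i] iT[OF that, of K] by linarith
  qed
  \<comment> \<open>In the rotated frame \<open>c * y - s * x\<close> measures the height: bar \<open>k\<close> fills the interval from \<open>e + k\<close> to \<open>e + k + 1\<close>.
    The slanted side is the line \<open>x + y * \<tau> = l + H * \<tau>\<close>.\<close>
  have bar: "real M - real (n k) \<le> x$1" "0 \<le> x$2" "x$2 \<le> real H"
      "x$1 + x$2 * \<tau> \<le> l + real H * \<tau>"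
      "e + real k \<le> c * x$2 - s * x$1" "c * x$2 - s * x$1 \<le> e + real k + 1"
    if x: "x \<in> bar k" and k: "k < K" for x k
  proof -
    define px where "px = real M - real (n k) + s"
    define py where "py = z k - real (n k) * T"
    define a where "a = (x$1 - px) * c + (x$2 - py) * s"
    define b where "b = (x$2 - py) * c - (x$1 - px) * s"
    have ab: "0 \<le> a" "a \<le> real (n k)" "0 \<le> b" "b \<le> 1"
      using x unfolding bar_def mem_rectangle a_def b_def px_def py_def s_def c_def by auto
    have x1: "x$1 = px + a * c - b * s" and x2: "x$2 = py + a * s + b * c"
      unfolding a_def b_def using sc by algebra+
    have ac: "0 \<le> a * c" "0 \<le> a * s" "0 \<le> b * c" "0 \<le> b * s"
      "a * s \<le> real (n k) * s" "b * s \<le> s" "b * c \<le> c"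
      using ab s c by (auto intro!: mult_right_mono mult_left_le_one_le)
    show "real M - real (n k) \<le> x$1" unfolding x1 px_def using ac by linarith
    have "real (n k) * T \<le> real M * T" using n(2)[OF k] T by (intro mult_right_mono) auto
    moreover have "z0 \<le> z k" using z_mono[of 0 k] z[of 0] by simp
    moreover have "(real M + 1) * T = real M * T + T" by (simp add: distrib_right)
    ultimately have "0 \<le> py" unfolding py_def using z0 T by linarith
    then show "0 \<le> x$2" unfolding x2 using ac by linarith
    have "real (n k) * s \<le> real (n k) * T" using sT by (simp add: mult_left_mono)
    moreover have "c \<le> 1 / c" using c by (simp add: field_simps mult_le_one)
    moreover have "z k + 1 / c = z (Suc k)" unfolding z by (simp add: add_divide_distrib)
    moreover have "z (Suc k) \<le> z K" using k by (intro z_mono) auto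
    ultimately show "x$2 \<le> real H" unfolding x2 py_def using ac zK by linarith
    have "c * x$2 - s * x$1 = b + c * py - s * px"
      unfolding x1 x2 using sc by algebra
    also have "c * py = c * z k - real (n k) * s" unfolding py_def cT[symmetric] by (simp add: algebra_simps)
    also have "c * z k = c * z0 + real k" by (rule cz)
    finally have F: "c * x$2 - s * x$1 = e + real k + b"
      unfolding e_def px_def by (simp add: algebra_simps)
    show "e + real k \<le> c * x$2 - s * x$1" "c * x$2 - s * x$1 \<le> e + real k + 1"
      unfolding F using ab by auto
    have "b * (c * \<tau> - s) \<le> 0" using ab \<tau> by (simp add: mult_nonneg_nonpos)
    moreover have "a * (c + s * \<tau>) \<le> real (n k) * (c + s * \<tau>)"
      using ab s c \<tau> by (intro mult_right_mono) auto
    moreover have "0 \<le> real (n k) * \<tau> * (T - s)" using \<tau> sT by simp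
    moreover have "real M + s - real (n k) * (1 - c) \<le> l + (real H - z k) * \<tau>"
      using fit[OF k] unfolding \<tau>_def .
    ultimately show "x$1 + x$2 * \<tau> \<le> l + real H * \<tau>"
      unfolding x1 x2 px_def py_def by (simp add: algebra_simps)
  qed
  have bot: "real M - real i - 1 \<le> x$1" "x$1 \<le> real M - real i" "0 \<le> x$2" "x$2 \<le> real H"
      "c * x$2 - s * x$1 \<le> e + real (K - J i)"
    if x: "x \<in> bot i" and i: "i < M" for x i
  proof -
    have *: "real M - real i - 1 \<le> x$1" "x$1 \<le> real M - real i" "0 \<le> x$2" "x$2 \<le> real (B i)"
      using x unfolding bot_def mem_rectangle by auto
    then show "real M - real i - 1 \<le> x$1" "x$1 \<le> real M - real i" "0 \<le> x$2" by auto
    have "z (K - J i) \<le> z K" by (rule z_mono) simp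
    moreover have "0 \<le> (s + real i + 1) * T" using s T by simp
    ultimately show "x$2 \<le> real H" using * B(2)[OF i] zK by linarith
    have "c * x$2 \<le> c * (z (K - J i) - (s + real i + 1) * T)"
      using * B(2)[OF i] c by (intro mult_left_mono) auto
    also have "\<dots> = c * z (K - J i) - (s + real i + 1) * (c * T)" by (simp add: algebra_simps)
    also have "c * T = s" by (rule cT)
    also have "c * z (K - J i) = c * z0 + real (K - J i)" by (rule cz)
    finally have "c * x$2 \<le> c * z0 + real (K - J i) - (s + real i + 1) * s" .
    moreover have "s * (real M - real i - 1) \<le> s * x$1" using * s by (intro mult_left_mono) auto
    ultimately show "c * x$2 - s * x$1 \<le> e + real (K - J i)"
      unfolding e_def by (simp add: algebra_simps)
  qed
  have top: "real M - real i - 1 \<le> x$1" "x$1 \<le> real M - real i" "0 \<le> x$2" "x$2 \<le> real H"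
      "e + real K \<le> c * x$2 - s * x$1"
    if x: "x \<in> top i" and i: "i < M" for x i
  proof -
    have *: "real M - real i - 1 \<le> x$1" "x$1 \<le> real M - real i" "real H - real (t i) \<le> x$2" "x$2 \<le> real H"
      using x unfolding top_def mem_rectangle by auto
    then show "real M - real i - 1 \<le> x$1" "x$1 \<le> real M - real i" "x$2 \<le> real H" by auto
    show "0 \<le> x$2" using * tH[OF i] by linarith
    have "c * (z K - (s + real i) * T) \<le> c * x$2"
      using * t(2)[of i] c by (intro mult_left_mono) auto
    moreover have "c * (z K - (s + real i) * T) = c * z K - (s + real i) * (c * T)" by (simp add: algebra_simps)
    moreover have "c * z K = c * z0 + real K" by (rule cz)
    moreover have "s * x$1 \<le> s * (real M - real i)" using * s by (intro mult_left_mono) auto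
    ultimately show "e + real K \<le> c * x$2 - s * x$1"
      unfolding e_def cT by (simp add: algebra_simps)
  qed
  have inT: "x \<in> ?T" if "0 \<le> x$1" "0 \<le> x$2" "x$2 \<le> real H" "x$1 + x$2 * \<tau> \<le> l + real H * \<tau>" for x
    using that unfolding mem_right_trapezoid \<tau>_def by (simp add: algebra_simps)
  have inT': "x \<in> ?T" if "0 \<le> x$1" "0 \<le> x$2" "x$2 \<le> real H" "x$1 \<le> l" for x
  proof (rule inT)
    have "x$2 * \<tau> \<le> real H * \<tau>" using that \<tau> by (intro mult_right_mono) auto
    then show "x$1 + x$2 * \<tau> \<le> l + real H * \<tau>" using that by linarith
  qed (use that in auto)
  \<comment> \<open>Pieces are separated by lines of slope \<open>T\<close>, except that two columns, or a column and a
    bar whose left end lies to the right of it, are separated by a vertical line.\<close>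
  have bar_bar: "interior (bar k) \<inter> interior (bar k') = {}" if kk: "k < k'" "k' < K" for k k'
  proof (rule interiors_separated[where \<alpha>="-s" and \<beta>="c" and \<gamma>="e + real k + 1"])
    show "-s * x$1 + c * x$2 \<le> e + real k + 1" if "x \<in> bar k" for x
      using bar(6)[OF that order_less_trans[OF kk]] by simp
    show "e + real k + 1 \<le> -s * x$1 + c * x$2" if "x \<in> bar k'" for x
      using bar(5)[OF that kk(2)] kk(1) by linarith
  qed (use s in simp)
  have bot_bar: "interior (bot i) \<inter> interior (bar k) = {}" if ik: "i < M" "k < K" for i k
  proof (cases "i < n k")
    case True
    then have le: "K - J i \<le> k" unfolding J_def using above_iff_ge_index[OF n(1) ik(2)] by blast
    show ?thesis
    proof (rule interiors_separated[where \<alpha>="-s" and \<beta>=c and \<gamma>="e + real k"])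
      show "-s * x$1 + c * x$2 \<le> e + real k" if "x \<in> bot i" for x
        using bot(5)[OF that ik(1)] le by linarith
      show "e + real k \<le> -s * x$1 + c * x$2" if "x \<in> bar k" for x
        using bar(5)[OF that ik(2)] by simp
    qed (use s in simp)
  next
    case False
    show ?thesis
    proof (rule interiors_separated[where \<alpha>=1 and \<beta>=0 and \<gamma>="real M - real i"])
      show "1 * x$1 + 0 * x$2 \<le> real M - real i" if "x \<in> bot i" for x
        using bot(2)[OF that ik(1)] by simp
      show "real M - real i \<le> 1 * x$1 + 0 * x$2" if "x \<in> bar k" for x
        using bar(1)[OF that ik(2)] False by simp
    qed simp
  qed
  have bar_top: "interior (bar k) \<inter> interior (top i) = {}" if ik: "i < M" "k < K" for i k
  proof (rule interiors_separated[where \<alpha>="-s" and \<beta>="c" and \<gamma>="e + real K"])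
    show "-s * x$1 + c * x$2 \<le> e + real K" if "x \<in> bar k" for x
      using bar(6)[OF that ik(2)] ik by linarith
    show "e + real K \<le> -s * x$1 + c * x$2" if "x \<in> top i" for x
      using top(5)[OF that ik(1)] by simp
  qed (use s in simp)
  have bot_top: "interior (bot i) \<inter> interior (top j) = {}" if ij: "i < M" "j < M" for i j
  proof (rule interiors_separated[where \<alpha>="-s" and \<beta>="c" and \<gamma>="e + real K"])
    show "-s * x$1 + c * x$2 \<le> e + real K" if "x \<in> bot i" for x
      using bot(5)[OF that ij(1)] by linarith
    show "e + real K \<le> -s * x$1 + c * x$2" if "x \<in> top j" for x
      using top(5)[OF that ij(2)] by simp
  qed (use s in simp)
  have bot_bot: "interior (bot i) \<inter> interior (bot j) = {}" if ij: "j < i" "i < M" for i j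
  proof (rule interiors_separated[where \<alpha>="1" and \<beta>="0" and \<gamma>="real M - real i"])
    show "1 * x$1 + 0 * x$2 \<le> real M - real i" if "x \<in> bot i" for x
      using bot(2)[OF that ij(2)] by simp
    show "real M - real i \<le> 1 * x$1 + 0 * x$2" if "x \<in> bot j" for x
      using bot(1)[OF that order_less_trans[OF ij]] ij(1) by linarith
  qed (use s in simp)
  have top_top: "interior (top i) \<inter> interior (top j) = {}" if ij: "j < i" "i < M" for i j
  proof (rule interiors_separated[where \<alpha>="1" and \<beta>="0" and \<gamma>="real M - real i"])
    show "1 * x$1 + 0 * x$2 \<le> real M - real i" if "x \<in> top i" for x
      using top(2)[OF that ij(2)] by simp
    show "real M - real i \<le> 1 * x$1 + 0 * x$2" if "x \<in> top j" for x
      using top(1)[OF that order_less_trans[OF ij]] ij(1) by linarith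
  qed (use s in simp)
  let ?I = "{..<K} <+> ({2..<M} <+> {2..<M})"
  let ?A = "case_sum bar (case_sum bot top)"
  let ?r = "case_sum (\<lambda>k. real (n k)) (case_sum (\<lambda>i. real (B i)) (\<lambda>i. real (t i)))"
  have "packable ?T (\<Sum>i\<in>?I. ?r i)"
  proof (rule packable_family[where A = ?A])
    show "finite ?I" by simp
    show "packable (?A i) (?r i)" if "i \<in> ?I" for i
      using packable_grid[of _ _ _ 1] packable_grid[of _ _ 1]
      by (auto simp: bar_def bot_def top_def split: sum.split)
    show "?A i \<subseteq> ?T" if i: "i \<in> ?I" for i
    proof
      fix x assume x: "x \<in> ?A i"
      consider k where "i = Inl k" "k < K" | j where "i = Inr (Inl j)" "2 \<le> j" "j < M"
        | j where "i = Inr (Inr j)" "2 \<le> j" "j < M" using i by auto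
      then show "x \<in> ?T"
      proof cases
        case 1
        then show ?thesis using bar[of x k] x n(2)[of k] by (intro inT) auto
      next
        case 2
        then show ?thesis using bot[of x j] x l by (intro inT') auto
      next
        case 3
        then show ?thesis using top[of x j] x l by (intro inT') auto
      qed
    qed
    show "interior (?A i) \<inter> interior (?A j) = {}" if "i \<in> ?I" "j \<in> ?I" "i \<noteq> j" for i j
    proof -
      have bb: "interior (bar k) \<inter> interior (bar k') = {}" if "k \<noteq> k'" "k < K" "k' < K" for k k'
        using that bar_bar[of k k'] bar_bar[of k' k] by (metis Int_commute linorder_neqE_nat)
      have oo: "interior (bot k) \<inter> interior (bot k') = {}" if "k \<noteq> k'" "k < M" "k' < M" for k k'
        using that bot_bot[of k k'] bot_bot[of k' k] by (metis Int_commute linorder_neqE_nat)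
      have tt: "interior (top k) \<inter> interior (top k') = {}" if "k \<noteq> k'" "k < M" "k' < M" for k k'
        using that top_top[of k k'] top_top[of k' k] by (metis Int_commute linorder_neqE_nat)
      have cases: thesis if
        "\<And>k. x = Inl k \<Longrightarrow> k < K \<Longrightarrow> thesis" "\<And>j. x = Inr (Inl j) \<Longrightarrow> j < M \<Longrightarrow> thesis"
        "\<And>j. x = Inr (Inr j) \<Longrightarrow> j < M \<Longrightarrow> thesis" "x \<in> ?I" for x thesis
        using that by auto
      have rev: "i < M \<Longrightarrow> k < K \<Longrightarrow> interior (bar k) \<inter> interior (bot i) = {}"
        "i < M \<Longrightarrow> k < K \<Longrightarrow> interior (top i) \<inter> interior (bar k) = {}"
        "i < M \<Longrightarrow> j < M \<Longrightarrow> interior (top j) \<inter> interior (bot i) = {}" for i j k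
        using bot_bar[of i k] bar_top[of i k] bot_top[of i j] by (simp_all only: Int_commute)
      show ?thesis
        by (rule cases[OF _ _ _ that(1)]; rule cases[OF _ _ _ that(2)])
           (use that(3) in \<open>simp_all add: bb oo tt bot_bar bar_top bot_top rev\<close>)
    qed
  qed
  then show ?thesis
  proof (rule packable_mono)
    have "(\<Sum>i=2..<M. (z (K - J i) - (s + real i + 1) * T - 1) + (real H - z K + (s + real i) * T - 1))
       \<le> (\<Sum>i=2..<M. real (B i) + real (t i))"
    proof (rule sum_mono)
      fix i assume "i \<in> {2..<M}"
      then show "(z (K - J i) - (s + real i + 1) * T - 1) + (real H - z K + (s + real i) * T - 1)
          \<le> real (B i) + real (t i)"
        using B(1)[of i] t(1)[of i] by (intro add_mono) auto
    qed
    moreover have "(\<Sum>i\<in>?I. ?r i) = (\<Sum>k<K. real (n k)) + (\<Sum>i=2..<M. real (B i) + real (t i))"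
      by (simp add: sum.Plus sum.distrib)
    ultimately show "(\<Sum>k<K. real (n k)) + (\<Sum>i=2..<M. (z (K - J i) - (s + real i + 1) * T - 1)
         + (real H - z K + (s + real i) * T - 1)) \<le> (\<Sum>i\<in>?I. ?r i)"
      by linarith
  qed simp
qed

lemma sin_ge_cubic:
  assumes "0 \<le> (x::real)"
  shows "x - x^3 / 6 \<le> sin x"
proof -
  have "\<bar>sin x - (\<Sum>m<3. sin_coeff m * x ^ m)\<bar> \<le> inverse (fact 3) * \<bar>x\<bar> ^ 3"
    by (rule Maclaurin_sin_bound)
  moreover have "(\<Sum>m<3. sin_coeff m * x ^ m) = x"
    by (simp add: sin_coeff_def numeral_3_eq_3)
  moreover have "inverse (fact 3) * \<bar>x\<bar> ^ 3 = x^3 / 6"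
    using assms by (simp add: fact_numeral)
  ultimately show ?thesis by linarith
qed

lemma small_angle:
  fixes \<phi> :: real
  assumes "0 < \<phi>" "\<phi> \<le> 1/4"
  shows "0 < sin \<phi>" "sin \<phi> \<le> \<phi>" "31/32 \<le> cos \<phi>" "cos \<phi> < 1"
    "1 - cos \<phi> \<le> \<phi>\<^sup>2 / 2" "489/1000 * \<phi>\<^sup>2 \<le> 1 - cos \<phi>" "2 * (1 - cos \<phi>) \<le> sin \<phi>"
    "0 < tan \<phi>" "tan \<phi> \<le> 26/25 * \<phi>" "\<phi> < pi / 2"
proof -
  let ?s = "sin \<phi>" and ?c = "cos \<phi>"
  show pi: "\<phi> < pi / 2" using assms pi_gt3 by linarith
  show s0: "0 < ?s" using assms pi by (intro sin_gt_zero) auto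
  show s1: "?s \<le> \<phi>" using assms sin_x_le_x by simp
  have p2: "\<phi>\<^sup>2 \<le> 1/16" using power_mono[of \<phi> "1/4" 2] assms by (simp add: power2_eq_square)
  have "sin (\<phi>/2) \<le> \<phi>/2" "0 \<le> sin (\<phi>/2)" using assms pi sin_x_le_x[of "\<phi>/2"] by (auto intro!: sin_ge_zero)
  then have "(sin (\<phi>/2))\<^sup>2 \<le> (\<phi>/2)\<^sup>2" by (intro power_mono)
  moreover have "?c = 1 - 2 * (sin (\<phi>/2))\<^sup>2" using cos_double_sin[of "\<phi>/2"] by simp
  ultimately show D: "1 - ?c \<le> \<phi>\<^sup>2 / 2" by (simp add: power_divide)
  then show c: "31/32 \<le> ?c" using p2 by linarith
  have sc: "?s\<^sup>2 = (1 - ?c) * (1 + ?c)" using sin_squared_eq[of \<phi>] by algebra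
  then have "0 < (1 - ?c) * (1 + ?c)" using s0 by (metis zero_less_power)
  then show c1: "?c < 1" using c by (simp add: zero_less_mult_iff)
  have "\<phi>^3 / 6 \<le> \<phi> * (1/96)"
    using p2 assms by (simp add: power3_eq_cube power2_eq_square)
  then have "95/96 * \<phi> \<le> ?s" using sin_ge_cubic[of \<phi>] assms by linarith
  then have "(95/96 * \<phi>)\<^sup>2 \<le> ?s\<^sup>2" using assms by (intro power_mono) auto
  also have "?s\<^sup>2 \<le> (1 - ?c) * 2" unfolding sc using c1 by (intro mult_left_mono) auto
  finally have "(95/96 * \<phi>)\<^sup>2 \<le> (1 - ?c) * 2" .
  moreover have "(95/96 * \<phi>)\<^sup>2 = 9025/9216 * \<phi>\<^sup>2"
    by (simp add: power_mult_distrib power_divide)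
  ultimately have "9025/9216 * \<phi>\<^sup>2 \<le> 2 - 2 * ?c" by simp
  moreover have "0 \<le> \<phi>\<^sup>2" by simp
  ultimately show "489/1000 * \<phi>\<^sup>2 \<le> 1 - ?c" by linarith
  have "4 * (1 - ?c) \<le> 1 + ?c" "0 \<le> 1 - ?c" using c c1 by (simp_all add: algebra_simps)
  then have "(1 - ?c) * (4 * (1 - ?c)) \<le> (1 - ?c) * (1 + ?c)" by (rule mult_left_mono)
  then have "(2 * (1 - ?c))\<^sup>2 \<le> ?s\<^sup>2" unfolding sc by (simp add: power2_eq_square algebra_simps)
  then show "2 * (1 - ?c) \<le> ?s" by (rule power2_le_imp_le) (use s0 in linarith)
  show "0 < tan \<phi>" using assms pi by (intro tan_gt_zero)
  have "?s * 31 \<le> \<phi> * 31" "25 * \<phi> \<le> (26 * ?c) * \<phi>" using s1 c assms by auto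
  then show "tan \<phi> \<le> 26/25 * \<phi>" unfolding tan_def using c s1 by (simp add: field_simps)
qed

text \<open>Across a layer the width grows by at most 1. A tilted row of \<open>n\<close> squares has the horizontal extent
  \<open>n * cos \<phi> + sin \<phi>\<close>, so replacing one of its squares by an upright one makes the whole row longer by
  \<open>D = 1 - cos \<phi>\<close>. With the total number \<open>M\<close> of squares fixed, the row therefore follows the slanted side up to an
  error \<open>D\<close>, if \<open>n\<close> is chosen suitably, and \<open>n\<close> never exceeds about \<open>2 / D\<close>. All tilted rows have
  the same angle, so that no wedges arise between them.

  The loss \<open>5/4 * \<phi> * H\<close> stems from the saw teeth at both ends of each tilted row and from the error \<open>D\<close>; the
  loss \<open>14 / \<phi>\<^sup>2\<close> is mainly due to two squares in each of the \<open>\<nu> \<approx> 4 / \<phi>\<^sup>2\<close> columns that tilted rows can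
  reach.\<close>
lemma trapezoid_layer:
  fixes \<phi> l \<theta> :: real and H :: nat
  assumes \<phi>: "0 < \<phi>" "\<phi> \<le> 1/4" and \<theta>: "0 \<le> tan \<theta>" "real H * tan \<theta> \<le> 1"
    and l: "5 / \<phi>\<^sup>2 \<le> l"
  shows "packable (right_trapezoid 0 l (real H) \<theta>)
    (l * real H + (real H)\<^sup>2 * tan \<theta> / 2 - (5/4 * \<phi> * real H + 14 / \<phi>\<^sup>2))"
proof -
  define s c T D \<tau> where "s = sin \<phi>" and "c = cos \<phi>" and "T = tan \<phi>" and "D = 1 - c" and "\<tau> = tan \<theta>"
  note sm = small_angle[OF \<phi>]
  have s: "0 < s" "s \<le> \<phi>" "2 * D \<le> s" and c: "31/32 \<le> c" "c < 1"
    and D: "D \<le> \<phi>\<^sup>2 / 2" "489/1000 * \<phi>\<^sup>2 \<le> D" and T: "0 < T" "T \<le> 26/25 * \<phi>"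
    unfolding s_def c_def T_def D_def by (rule sm)+
  have p2: "0 < \<phi>\<^sup>2" "\<phi>\<^sup>2 \<le> 1/16" using \<phi> power_mono[of \<phi> "1/4" 2] by (auto simp: power2_eq_square)
  have "0 < 489/1000 * \<phi>\<^sup>2" using p2 by simp
  with D(2) have D0: "0 < D" by linarith
  define Q where "Q = 1 / \<phi>\<^sup>2"
  have Q16: "16 \<le> Q" using p2 by (simp add: Q_def field_simps)
  \<comment> \<open>No tilted row needs more than \<open>\<nu>\<close> squares, since \<open>M + s\<close> exceeds the available width by at most \<open>2 + s\<close>.\<close>
  define \<nu> where "\<nu> = nat \<lceil>(2 + s) / D\<rceil>"
  have \<nu>1: "(2 + s) / D \<le> real \<nu>" unfolding \<nu>_def by linarith
  have "(2 + s) / D \<le> (9/4) / (489/1000 * \<phi>\<^sup>2)"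
    using s \<phi> D D0 p2 by (intro frac_le) auto
  also have "\<dots> = 2250/489 * Q" by (simp add: Q_def)
  finally have "(2 + s) / D \<le> 2250/489 * Q" .
  moreover have "0 \<le> (2 + s) / D" using s D0 by simp
  then have "real \<nu> \<le> (2 + s) / D + 1" unfolding \<nu>_def by linarith
  ultimately have "real \<nu> \<le> 2250/489 * Q + 1" by linarith
  then have \<nu>2: "real \<nu> \<le> 467/100 * Q" using Q16 by linarith
  have lQ: "5 * Q \<le> l" using l by (simp add: Q_def)
  then have "real \<nu> \<le> l" using \<nu>2 Q16 by linarith
  then have fl: "int \<nu> \<le> \<lfloor>l\<rfloor>" by (simp add: le_floor_iff)
  define m where "m = nat (\<lfloor>l\<rfloor> - int \<nu>)"
  define l' where "l' = l - real m"
  have m: "real m = real_of_int \<lfloor>l\<rfloor> - real \<nu>" using fl by (simp add: m_def)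
  have l': "real \<nu> \<le> l'" "l' \<le> real \<nu> + 1" unfolding l'_def m by linarith+
  \<comment> \<open>At this height the line of slope \<open>T\<close> through the right end of the lowest row stays above the bottom edge
    as far to the left as any row reaches.\<close>
  define z0 where "z0 = (real \<nu> + 3) * T"
  have z0: "0 < z0" "z0 \<le> 127/100 * Q"
  proof -
    show "0 < z0" using T by (simp add: z0_def)
    have "z0 \<le> (467/100 * Q + 3) * (26/25 * \<phi>)" unfolding z0_def using \<nu>2 T Q16 by (intro mult_mono) auto
    also have "\<dots> \<le> (467/100 * Q + 3/16 * Q) * (26/25 * (1/4))" using Q16 \<phi> by (intro mult_mono) auto
    also have "\<dots> \<le> 127/100 * Q" using Q16 by simp
    finally show "z0 \<le> 127/100 * Q" .
  qed
  have phiQ: "14 / \<phi>\<^sup>2 = 14 * Q" by (simp add: Q_def)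
  define W where "W = 5/4 * \<phi> * real H + 14 * Q"
  have HH: "(real H)\<^sup>2 * \<tau> \<le> real H" using \<theta> mult_left_mono[of "real H * \<tau>" 1 "real H"]
    by (simp add: \<tau>_def power2_eq_square mult_ac)
  have "packable (right_trapezoid 0 l' (real H) \<theta>) (l' * real H + (real H)\<^sup>2 * \<tau> / 2 - W)"
  proof (cases "z0 \<le> real H")
    case False
    have "packable (right_trapezoid 0 l' (real H) \<theta>) (real \<nu> * real H)"
      by (rule packable_trapezoid_grid) (use l' \<theta> in auto)
    then show ?thesis
    proof (rule packable_mono)
      have "(l' - real \<nu>) * real H \<le> 1 * real H" using l' by (intro mult_right_mono) auto
      moreover have "0 \<le> 5/4 * \<phi> * real H" using \<phi> by simp
      ultimately show "l' * real H + (real H)\<^sup>2 * \<tau> / 2 - W \<le> real \<nu> * real H"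
        using HH False z0 Q16 unfolding W_def by (simp add: algebra_simps)
    qed simp
  next
    case True
    define K where "K = nat \<lfloor>c * (real H - z0)\<rfloor>"
    define z where "z = (\<lambda>k::nat. z0 + real k / c)"
    define n where "n = (\<lambda>k. nat \<lceil>(real (\<nu> + 2) + s - l' - (real H - z k) * \<tau>) / D\<rceil>)"
    define J where "J = (\<lambda>i. card {k. k < K \<and> i < n k})"
    have c0: "0 < c" using c by simp
    have "0 \<le> c * (real H - z0)" using True c0 by simp
    then have K: "real K \<le> c * (real H - z0)" "c * (real H - z0) - 1 \<le> real K"
      unfolding K_def by linarith+
    define G where "G = real K / c"
    have G: "real K = c * G" "0 \<le> G" "G \<le> real H - z0" "real H - z0 - 32/31 \<le> G"
    proof -
      show KG: "real K = c * G" and "0 \<le> G" using c0 by (auto simp: G_def)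
      show "G \<le> real H - z0" using K(1) c0 unfolding KG by simp
      have "1 \<le> c * (32/31)" using c by simp
      then have "c * (real H - z0 - 32/31) \<le> c * G" using K(2) unfolding KG by (simp add: algebra_simps)
      then show "real H - z0 - 32/31 \<le> G" using c0 by simp
    qed
    have zmono: "z i \<le> z j" if "i \<le> j" for i j using that c0 by (simp add: z_def divide_right_mono)
    have zK: "z K \<le> real H" using G by (simp add: z_def G_def)
    have zk: "z k \<le> real H" if "k < K" for k using zmono[of k K] zK that by simp
    have \<tau>0: "0 \<le> \<tau>" using \<theta> by (simp add: \<tau>_def)
    \<comment> \<open>In a layer tall enough for a tilted row, the slanted side deviates less from the vertical than the row
      does from the horizontal.\<close>
    have \<tau>T: "\<tau> \<le> T"
    proof (rule ccontr)
      assume "\<not> \<tau> \<le> T"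
      then have "real H * T \<le> real H * \<tau>" by (intro mult_left_mono) auto
      then have "real H * T \<le> 1" using \<theta> by (simp add: \<tau>_def)
      moreover have "z0 * T \<le> real H * T" using True T by (intro mult_right_mono) auto
      moreover have "2 \<le> z0 * T"
      proof -
        have "s * s = D * (1 + c)" using sin_squared_eq[of \<phi>] unfolding s_def c_def D_def by algebra
        moreover have "D * 1 \<le> D * (1 + c)" using c0 D0 by (intro mult_left_mono) auto
        ultimately have "D \<le> s * s" by simp
        also have "s \<le> T" using c0 c s by (simp add: s_def c_def T_def tan_def field_simps mult_left_le)
        then have "s * s \<le> T * T" using s by (intro mult_mono) auto
        finally have "D \<le> T * T" .
        moreover have "2 / D \<le> (2 + s) / D" using s D0 by (intro divide_right_mono) auto
        then have "2 / D \<le> real \<nu> + 3" using \<nu>1 by linarith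
        ultimately have "2 / D * D \<le> (real \<nu> + 3) * (T * T)" using D0 by (intro mult_mono) auto
        then show ?thesis using D0 by (simp add: z0_def mult.assoc)
      qed
      ultimately show False by linarith
    qed
    have arg: "s \<le> real (\<nu> + 2) + s - l' - (real H - z k) * \<tau>"
      "real (\<nu> + 2) + s - l' - (real H - z k) * \<tau> \<le> 2 + s" if "k < K" for k
    proof -
      have "0 \<le> z k" using z0 c0 by (simp add: z_def)
      then have "(real H - z k) * \<tau> \<le> real H * \<tau>" using \<tau>0 by (intro mult_right_mono) auto
      moreover have "0 \<le> (real H - z k) * \<tau>" using zk[OF that] \<tau>0 by simp
      ultimately show "s \<le> real (\<nu> + 2) + s - l' - (real H - z k) * \<tau>"
        "real (\<nu> + 2) + s - l' - (real H - z k) * \<tau> \<le> 2 + s"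
        using \<theta>(2) l' unfolding \<tau>_def[symmetric] by auto
    qed
    have n_lower: "(real (\<nu> + 2) + s - l' - (real H - z k) * \<tau>) / D \<le> real (n k)" for k
      unfolding n_def by linarith
    have n_upper: "real (n k) * D \<le> real (\<nu> + 2) + s - l' - (real H - z k) * \<tau> + D" if "k < K" for k
    proof -
      let ?a = "real (\<nu> + 2) + s - l' - (real H - z k) * \<tau>"
      have "0 \<le> ?a / D" using arg(1)[OF that] s D0 by (intro divide_nonneg_pos) auto
      then have "real (n k) \<le> ?a / D + 1" unfolding n_def by linarith
      then have "real (n k) * D \<le> (?a / D + 1) * D" using D0 by (intro mult_right_mono) auto
      also have "\<dots> = ?a + D" using D0 by (simp add: field_simps)
      finally show ?thesis .
    qed
    have n_le: "n k \<le> \<nu>" if "k < K" for k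
    proof -
      have "(real (\<nu> + 2) + s - l' - (real H - z k) * \<tau>) / D \<le> (2 + s) / D"
        using arg(2)[OF that] D0 by (intro divide_right_mono) auto
      then show ?thesis unfolding n_def \<nu>_def by (intro nat_mono ceiling_mono)
    qed
    have n_ge: "2 \<le> n k" if "k < K" for k
    proof -
      have "2 \<le> s / D" using s D0 by (simp add: field_simps)
      also have "s / D \<le> (real (\<nu> + 2) + s - l' - (real H - z k) * \<tau>) / D"
        using arg(1)[OF that] D0 by (intro divide_right_mono) auto
      finally show ?thesis using n_lower[of k] by linarith
    qed
    have "mono n"
    proof (rule monoI)
      fix i j :: nat assume "i \<le> j"
      then have "(real H - z j) * \<tau> \<le> (real H - z i) * \<tau>"
        using zmono[of i j] \<tau>0 by (intro mult_right_mono) auto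
      then show "n i \<le> n j" unfolding n_def using D0
        by (intro nat_mono ceiling_mono divide_right_mono) auto
    qed
    have P: "packable (right_trapezoid 0 l' (real H) \<theta>)
      ((\<Sum>k<K. real (n k)) + (\<Sum>i=2..<\<nu> + 2. (z (K - J i) - (s + real i + 1) * T - 1)
         + (real H - z K + (s + real i) * T - 1)))" (is "packable _ ?r")
      unfolding J_def s_def T_def
    proof (rule packable_tilted_layer)
      show "real (\<nu> + 2) + sin \<phi> - real (n k) * (1 - cos \<phi>) \<le> l' + (real H - z k) * tan \<theta>" if "k < K" for k
        using n_lower[of k] D0 unfolding s_def[symmetric] c_def[symmetric] D_def[symmetric] \<tau>_def[symmetric]
        by (simp add: field_simps)
      show "(real (\<nu> + 2) + 1) * tan \<phi> \<le> z0" by (simp add: z0_def T_def add.commute)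
    qed (use \<phi> sm(10) \<open>mono n\<close> zK l' \<theta> \<tau>T in \<open>auto simp: z_def c_def \<tau>_def T_def intro: le_SucI n_le\<close>)
    define S where "S = (\<Sum>k<K. real (n k))"
    have J_le: "J i \<le> K" for i
    proof -
      have "J i \<le> card {..<K}" unfolding J_def by (rule card_mono) auto
      then show ?thesis by simp
    qed
    have "(\<Sum>k<K. n k) = (\<Sum>i<\<nu> + 2. J i)"
      unfolding J_def by (rule sum_count_above) (use n_le in \<open>auto intro: le_SucI\<close>)
    also have "{..<\<nu> + 2} = {0, 1} \<union> {2..<\<nu> + 2}" by auto
    also have "(\<Sum>i\<in>{0, 1} \<union> {2..<\<nu> + 2}. J i) = J 0 + J 1 + (\<Sum>i=2..<\<nu> + 2. J i)"
      by (subst sum.union_disjoint) auto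
    finally have "(\<Sum>k<K. n k) = J 0 + J 1 + (\<Sum>i=2..<\<nu> + 2. J i)" .
    moreover have "J 0 = K" "J 1 = K"
    proof -
      have "{k. k < K \<and> 0 < n k} = {..<K}" "{k. k < K \<and> 1 < n k} = {..<K}" using n_ge by fastforce+
      then show "J 0 = K" "J 1 = K" by (simp_all add: J_def)
    qed
    ultimately have "(\<Sum>k<K. n k) = 2 * K + (\<Sum>i=2..<\<nu> + 2. J i)" by (simp only: mult_2)
    then have "real (\<Sum>k<K. n k) = real (2 * K + (\<Sum>i=2..<\<nu> + 2. J i))" by (simp only:)
    then have SJ: "(\<Sum>i=2..<\<nu> + 2. real (J i)) = S - 2 * real K"
      unfolding S_def of_nat_add of_nat_sum of_nat_mult of_nat_numeral by linarith
    \<comment> \<open>A tilted square that crosses the column counts 1 but takes up the vertical extent \<open>1 / c\<close>; the tilt of the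
      lines costs \<open>T\<close> across the column, and the two roundings cost 2.\<close>
    have summand: "(z (K - J i) - (s + real i + 1) * T - 1) + (real H - z K + (s + real i) * T - 1)
        = real H - T - 2 - real (J i) / c" for i
      using J_le[of i] by (simp add: z_def of_nat_diff algebra_simps diff_divide_distrib)
    have r: "?r = S + real \<nu> * (real H - T - 2) - (S - 2 * real K) / c"
    proof -
      have "(\<Sum>i=2..<\<nu> + 2. real H - T - 2 - real (J i) / c)
          = (\<Sum>i=2..<\<nu> + 2. real H - T - 2) - (\<Sum>i=2..<\<nu> + 2. real (J i) / c)"
        by (rule sum_subtractf)
      also have "(\<Sum>i=2..<\<nu> + 2. real H - T - 2) = real \<nu> * (real H - T - 2)"
        by (simp only: sum_constant card_atLeastLessThan add_diff_cancel_right')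
      also have "(\<Sum>i=2..<\<nu> + 2. real (J i) / c) = (S - 2 * real K) / c"
        by (simp only: sum_divide_distrib[symmetric] SJ)
      finally show ?thesis unfolding summand S_def by linarith
    qed
    have "S * D \<le> (\<Sum>k<K. real (\<nu> + 2) + s - l' - (real H - z k) * \<tau> + D)"
      unfolding S_def sum_distrib_right by (rule sum_mono) (use n_upper in auto)
    also have "\<dots> = (\<Sum>k<K. real (\<nu> + 2) + s - l' + D - (real H - z0) * \<tau> + real k * (\<tau> / c))"
      by (rule sum.cong) (auto simp: z_def algebra_simps)
    also have "\<dots> = real K * (real (\<nu> + 2) + s - l' + D - (real H - z0) * \<tau>) + (\<Sum>k<K. real k) * (\<tau> / c)"
      by (simp only: sum.distrib sum_distrib_right sum_constant card_lessThan)
    also have "\<dots> \<le> real K * (real (\<nu> + 2) + s - l' + D - (real H - z0) * \<tau>) + (real K)\<^sup>2 / 2 * (\<tau> / c)"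
    proof -
      have "(\<Sum>k<K. real k) \<le> (real K)\<^sup>2 / 2"
        by (induction K) (auto simp: power2_eq_square algebra_simps)
      then show ?thesis using \<tau>0 c0 by (intro add_left_mono mult_right_mono) auto
    qed
    finally have SD: "S * D \<le> real K * (real (\<nu> + 2) + s - l' + D - (real H - z0) * \<tau>) + (real K)\<^sup>2 / 2 * (\<tau> / c)" .
    have "(real K)\<^sup>2 / 2 * (\<tau> / c) = c * (G\<^sup>2 / 2 * \<tau>)"
      unfolding G using c0 by (simp add: power2_eq_square)
    then have "S * D \<le> c * (G * (real (\<nu> + 2) + s - l' + D - (real H - z0) * \<tau>) + G\<^sup>2 / 2 * \<tau>)"
      using SD unfolding G(1) by (simp add: algebra_simps)
    moreover have "S - (S - 2 * real K) / c = 2 * G - S * D / c"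
      unfolding G_def D_def using c0 by (simp add: field_simps)
    moreover have "S * D / c \<le> X" if "S * D \<le> c * X" for X
      using that c0 by (simp add: pos_divide_le_eq mult.commute)
    ultimately have "2 * G - (G * (real (\<nu> + 2) + s - l' + D - (real H - z0) * \<tau>) + G\<^sup>2 / 2 * \<tau>)
        \<le> S - (S - 2 * real K) / c" by (metis diff_left_mono)
    then have r_ge: "real \<nu> * (real H - T - 2) + G * (l' - real \<nu> - s - D)
        + (G * (real H - z0) - G\<^sup>2 / 2) * \<tau> \<le> ?r"
      unfolding r by (simp add: algebra_simps)
    \<comment> \<open>The vertical extent that is not taken up by tilted rows.\<close>
    define g where "g = real H - G"
    have g: "0 \<le> g" "g \<le> real H" "g \<le> z0 + 32/31" using G z0 by (auto simp: g_def)
    have e1: "(l' - real \<nu>) * g \<le> g" using l' g by (intro mult_left_le_one_le) auto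
    have e2: "G * (s + D) \<le> real H * (5/4 * \<phi>)"
    proof -
      have "\<phi>\<^sup>2 / 2 \<le> \<phi> / 4" using \<phi> by (simp add: power2_eq_square)
      then show ?thesis using s D D0 G z0 \<phi> by (intro mult_mono) auto
    qed
    have "g * \<tau> \<le> real H * \<tau>" using g \<tau>0 by (intro mult_right_mono) auto
    then have gt: "g * \<tau> \<le> 1" using \<theta> by (simp add: \<tau>_def)
    have e3: "g\<^sup>2 / 2 * \<tau> \<le> g / 2" using mult_left_mono[OF gt g(1)] by (simp add: power2_eq_square mult_ac)
    have "G * \<tau> \<le> real H * \<tau>" using G z0 \<tau>0 by (intro mult_right_mono) auto
    then have Gt: "G * \<tau> \<le> 1" using \<theta> by (simp add: \<tau>_def)
    have e4: "G * z0 * \<tau> \<le> z0" using mult_left_mono[OF Gt, of z0] z0 by (simp add: mult_ac)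
    have e5: "real \<nu> * (T + 2) \<le> 467/100 * Q * (226/100)"
      using \<nu>2 T \<phi> Q16 by (intro mult_mono) auto
    have "l' * real H + (real H)\<^sup>2 * \<tau> / 2 - (real \<nu> * (real H - T - 2) + G * (l' - real \<nu> - s - D)
        + (G * (real H - z0) - G\<^sup>2 / 2) * \<tau>)
       = real \<nu> * (T + 2) + (l' - real \<nu>) * g + G * (s + D) + g\<^sup>2 / 2 * \<tau> + G * z0 * \<tau>"
      unfolding g_def by (simp add: field_simps power2_eq_square)
    also have "\<dots> \<le> 467/100 * Q * (226/100) + g + real H * (5/4 * \<phi>) + g / 2 + z0"
      by (intro add_mono e1 e2 e3 e4 e5)
    also have "\<dots> = 105542/10000 * Q + 3/2 * g + 5/4 * \<phi> * real H + z0" by simp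
    also have "\<dots> \<le> W"
      using g(1,3) z0(2) Q16 unfolding W_def by linarith
    finally have "l' * real H + (real H)\<^sup>2 * \<tau> / 2 - W \<le> ?r" using r_ge by linarith
    then show ?thesis using P packable_mono by blast
  qed
  then have "packable (right_trapezoid 0 (real m + l') (real H) \<theta>)
     (real m * real H + (l' * real H + (real H)\<^sup>2 * \<tau> / 2 - W))"
    by (rule packable_trapezoid_add_rectangle) (use \<theta> l' in auto)
  then show ?thesis
    unfolding W_def \<tau>_def phiQ l'_def by (simp add: algebra_simps)
qed

section \<open>Tall trapezoids\<close>

text \<open>Layers of integer height are stacked from below, each one at least as wide as \<open>a\<close>; the remaining part of height
  \<open>r\<close> at the top is packed with upright squares. The areas add up exactly, so only the losses have to be
  summed.\<close>
lemma packable_trapezoid_layers: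
  fixes a r E \<theta> :: real and q H :: nat
  assumes \<theta>: "0 \<le> tan \<theta>"
    and layer: "\<And>l. a \<le> l \<Longrightarrow> packable (right_trapezoid 0 l (real H) \<theta>) (l * real H + (real H)\<^sup>2 * tan \<theta> / 2 - E)"
    and a: "0 \<le> a" and r: "0 \<le> r" "r * tan \<theta> \<le> 1"
    and h: "h = real q * real H + r"
  shows "packable (right_trapezoid 0 a h \<theta>) (a * h + h\<^sup>2 * tan \<theta> / 2 - (real q * E + 2 * r + a))"
  using h
proof (induction q arbitrary: h)
  case 0
  have "packable (right_trapezoid 0 a r \<theta>) (real (nat \<lfloor>a\<rfloor>) * real (nat \<lfloor>r\<rfloor>))"
    by (rule packable_trapezoid_grid) (use a r \<theta> in linarith)+
  moreover have "r * (r * tan \<theta>) \<le> r * 1" using r by (intro mult_left_mono)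
  then have "a * r + r\<^sup>2 * tan \<theta> / 2 - (2 * r + a) \<le> real (nat \<lfloor>a\<rfloor>) * real (nat \<lfloor>r\<rfloor>)"
    using floor_grid_waste[OF a r(1)] r(1) by (simp add: power2_eq_square mult.assoc)
  ultimately show ?case using 0 packable_mono by fastforce
next
  case (Suc q)
  define h2 where "h2 = real q * real H + r"
  have h: "h = real H + h2" using Suc.prems by (simp add: h2_def algebra_simps)
  have h2: "0 \<le> h2" using r by (simp add: h2_def)
  have "packable (right_trapezoid 0 a (real H + h2) \<theta>)
     ((a + h2 * tan \<theta>) * real H + (real H)\<^sup>2 * tan \<theta> / 2 - E
      + (a * h2 + h2\<^sup>2 * tan \<theta> / 2 - (real q * E + 2 * r + a)))"
  proof (rule packable_trapezoid_stack)
    show "packable (right_trapezoid 0 a h2 \<theta>) (a * h2 + h2\<^sup>2 * tan \<theta> / 2 - (real q * E + 2 * r + a))"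
      by (rule Suc.IH) (simp add: h2_def)
    show "packable (right_trapezoid 0 (a + h2 * tan \<theta>) (real H) \<theta>)
       ((a + h2 * tan \<theta>) * real H + (real H)\<^sup>2 * tan \<theta> / 2 - E)"
      using \<theta> h2 by (intro layer) simp
  qed (use h2 in auto)
  then show ?case
    unfolding h by (rule packable_mono) (simp_all add: power2_eq_square algebra_simps)
qed

text \<open>There are about \<open>2 * u^3\<close> layers of height \<open>u^3 / 2\<close>, each losing about
  \<open>5/4 * \<phi> * u^3 / 2 + 14 / \<phi>\<^sup>2\<close>; an angle \<open>\<phi>\<close> of order \<open>1 / u\<close> balances the two terms and makes the total
  of order \<open>u^5\<close>. The estimates for a layer need \<open>\<phi> = 2 / u \<le> 1/4\<close>. For \<open>u \<le> 8\<close> it suffices to lose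
  about one square per row, since \<open>u^6 \<le> 8 * u^5\<close>.\<close>
lemma trapezoid_packing:
  fixes a h u \<theta> :: real
  assumes u: "2 \<le> u" and h: "u^6 \<le> h" "h \<le> u^6 + 1"
    and \<theta>: "0 \<le> tan \<theta>" "tan \<theta> \<le> 2 / u^3" and a: "5/4 * u\<^sup>2 \<le> a"
  shows "packable (right_trapezoid 0 a h \<theta>) (a * h + h\<^sup>2 * tan \<theta> / 2 - (10 * u^5 + a))"
proof -
  have u2: "4 \<le> u\<^sup>2" and u3: "8 \<le> u^3" and u5: "32 \<le> u^5"
    using power_mono[OF u, of 2] power_mono[OF u, of 3] power_mono[OF u, of 5] by auto
  have a1: "0 \<le> a" using a u2 by linarith
  have h0: "0 \<le> h" using h u by (smt (verit) zero_le_power)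
  have u35: "4 * u^3 \<le> u^5"
    using mult_right_mono[OF u2, of "u^3"] u3 by (simp add: eval_nat_numeral algebra_simps)
  show ?thesis
  proof (cases "u \<le> 8")
    case True
    define E where "E = 1 + tan \<theta> / 2"
    define q where "q = nat \<lfloor>h\<rfloor>"
    define r where "r = h - real q"
    have r: "0 \<le> r" "r \<le> 1" using h0 unfolding r_def q_def by linarith+
    have "2 / u^3 \<le> 2 / 8" using u3 by (intro frac_le) auto
    then have t: "tan \<theta> \<le> 1/4" using \<theta>(2) by linarith
    have "packable (right_trapezoid 0 a h \<theta>) (a * h + h\<^sup>2 * tan \<theta> / 2 - (real q * E + 2 * r + a))"
    proof (rule packable_trapezoid_layers[where H = 1])
      fix l assume "a \<le> l"
      then have "packable (right_trapezoid 0 l (real 1) \<theta>) (real (nat \<lfloor>l\<rfloor>) * real 1)"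
        using a1 \<theta> by (intro packable_trapezoid_grid) auto
      then show "packable (right_trapezoid 0 l (real 1) \<theta>) (l * real 1 + (real 1)\<^sup>2 * tan \<theta> / 2 - E)"
      proof (rule packable_mono)
        show "l * real 1 + (real 1)\<^sup>2 * tan \<theta> / 2 - E \<le> real (nat \<lfloor>l\<rfloor>) * real 1"
          unfolding E_def using \<open>a \<le> l\<close> a1 by (simp; linarith)
      qed simp
    next
      show "r * tan \<theta> \<le> 1" using mult_mono[of r 1 "tan \<theta>" 1] r \<theta> t by simp
    qed (use \<theta> a1 r in \<open>auto simp: r_def\<close>)
    moreover have "real q * E + 2 * r \<le> 10 * u^5"
    proof -
      have "real q * E \<le> h * E" using r \<theta> by (intro mult_right_mono) (auto simp: r_def E_def)
      also have "\<dots> \<le> (u^6 + 1) * (1 + 1 / u^3)"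
        unfolding E_def using h h0 \<theta> by (intro mult_mono) auto
      also have "\<dots> = u^6 + u^3 + 1 + 1 / u^3" using u by (simp add: field_simps eval_nat_numeral)
      finally have "real q * E \<le> u^6 + u^3 + 1 + 1 / u^3" .
      moreover have "1 / u^3 \<le> 1" using u u3 by (simp add: divide_le_eq)
      moreover have "u^6 \<le> 8 * u^5" using mult_right_mono[OF True, of "u^5"] u5 by (simp add: eval_nat_numeral algebra_simps)
      ultimately show ?thesis using u35 u5 r by linarith
    qed
    ultimately show ?thesis using packable_mono by fastforce
  next
    case False
    \<comment> \<open>\<open>H\<close> is the largest integer that guarantees \<open>H * tan \<theta> \<le> 1\<close>, and \<open>\<phi>\<close> is the smallest angle for which
      the hypothesis on \<open>a\<close> gives the tilted rows enough room.\<close>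
    define \<phi> where "\<phi> = 2 / u"
    define H where "H = nat \<lfloor>u^3 / 2\<rfloor>"
    define E where "E = 5/4 * \<phi> * real H + 14 / \<phi>\<^sup>2"
    define q where "q = nat \<lfloor>h / real H\<rfloor>"
    define r where "r = h - real q * real H"
    have y: "512 \<le> u^3" using power_mono[of 8 u 3] False by simp
    have H: "real H \<le> u^3 / 2" "u^3 / 2 - 1 \<le> real H" using y unfolding H_def by linarith+
    have H0: "0 < real H" using H y by linarith
    have q: "real q \<le> h / real H" "h / real H < real q + 1" using h0 H0 unfolding q_def by (auto; linarith)+
    then have r: "0 \<le> r" "r \<le> real H" using H0 unfolding r_def by (auto simp: field_simps)
    have "real H * tan \<theta> \<le> u^3 / 2 * (2 / u^3)" using H \<theta> u by (intro mult_mono) auto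
    then have Ht: "real H * tan \<theta> \<le> 1" using u by auto
    have "packable (right_trapezoid 0 a h \<theta>) (a * h + h\<^sup>2 * tan \<theta> / 2 - (real q * E + 2 * r + a))"
    proof (rule packable_trapezoid_layers)
      fix l assume l: "a \<le> l"
      show "packable (right_trapezoid 0 l (real H) \<theta>) (l * real H + (real H)\<^sup>2 * tan \<theta> / 2 - E)"
        unfolding E_def
      proof (rule trapezoid_layer)
        show "5 / \<phi>\<^sup>2 \<le> l" using a l u by (simp add: \<phi>_def power_divide)
      qed (use False \<theta> Ht in \<open>auto simp: \<phi>_def field_simps\<close>)
    next
      have "r * tan \<theta> \<le> real H * tan \<theta>" using r \<theta> by (intro mult_right_mono) auto
      then show "r * tan \<theta> \<le> 1" using Ht by linarith
    qed (use \<theta> a1 r in \<open>auto simp: r_def\<close>)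
    moreover have "real q * E + 2 * r \<le> 10 * u^5"
    proof -
      have "h / real H \<le> 201/100 * u^3"
      proof -
        have "201/100 * u^3 * (u^3 / 2 - 1) \<le> 201/100 * u^3 * real H" using H u by (intro mult_left_mono) auto
        moreover have "512 * u^3 \<le> u^3 * u^3" using y u by (intro mult_right_mono) auto
        moreover have "u^6 = u^3 * u^3" by (simp add: eval_nat_numeral)
        moreover have "201/100 * u^3 * (u^3 / 2 - 1) = 201/200 * (u^3 * u^3) - 201/100 * u^3"
          unfolding right_diff_distrib by simp
        ultimately have "h \<le> 201/100 * u^3 * real H" using h(2) y by linarith
        then show ?thesis using H0 by (simp add: pos_divide_le_eq)
      qed
      then have q3: "real q \<le> 201/100 * u^3" using q by linarith
      have "real q * E = 5/2 * (real q * real H) / u + 7/2 * (real q * u\<^sup>2)"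
        using u by (simp add: E_def \<phi>_def power_divide field_simps)
      moreover have "5/2 * (real q * real H) / u \<le> 5/2 * (u^6 + 1) / u"
      proof -
        have "real q * real H \<le> u^6 + 1" using h(2) r(1) unfolding r_def by linarith
        then show ?thesis using u by (intro divide_right_mono mult_left_mono) auto
      qed
      moreover have "5/2 * (u^6 + 1) / u = 5/2 * u^5 + 5/2 / u" using u by (simp add: field_simps eval_nat_numeral)
      moreover have "5/2 / u \<le> 5/4" using u by (simp add: field_simps)
      moreover have "real q * u\<^sup>2 \<le> 201/100 * u^3 * u\<^sup>2" using q3 by (intro mult_right_mono) auto
      moreover have "u^3 * u\<^sup>2 = u^5" by (simp add: eval_nat_numeral)
      moreover have "64 * u^3 \<le> u^5"
      proof -
        have "64 \<le> u\<^sup>2" using power_mono[of 8 u 2] False by simp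
        then have "64 * u^3 \<le> u\<^sup>2 * u^3" using u by (intro mult_right_mono) auto
        then show ?thesis by (simp add: eval_nat_numeral)
      qed
      ultimately show ?thesis using r H(1) y by linarith
    qed
    ultimately show ?thesis using packable_mono by fastforce
  qed
qed

section \<open>Strips with leaning columns\<close>

text \<open>A column of \<open>N \<ge> w\<close> squares becomes exactly as high as the strip when it leans over by an angle
  of about \<open>sqrt (2 / w)\<close>. The angle is found by the intermediate value theorem on an interval whose right
  end point has the sine \<open>7/4 / u^3\<close>, where the column is already too low.\<close>
lemma leaning_column_angle:
  fixes u w :: real
  assumes u: "2 \<le> u" and w: "u^6 \<le> w" "w \<le> real N" "real N < w + 1"
  obtains \<theta> where "0 \<le> \<theta>" "\<theta> < pi / 2" "real N * cos \<theta> + sin \<theta> = w"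
    "0 \<le> tan \<theta>" "tan \<theta> \<le> 9/5 / u^3" "35/36 \<le> cos \<theta>" "0 \<le> sin \<theta>"
proof -
  have u3: "8 \<le> u^3" using power_mono[OF u, of 3] by simp
  define \<sigma> where "\<sigma> = 7/4 / u^3"
  have "7/4 / u^3 \<le> 7/4 / 8" using u3 u by (intro divide_left_mono) auto
  then have \<sigma>: "0 < \<sigma>" "\<sigma> \<le> 7/32" using u by (auto simp: \<sigma>_def)
  define \<theta>0 where "\<theta>0 = arcsin \<sigma>"
  have sin0: "sin \<theta>0 = \<sigma>" unfolding \<theta>0_def using \<sigma> by (intro sin_arcsin) auto
  have b0: "0 \<le> \<theta>0" "\<theta>0 < pi / 2"
    using arcsin_lt_bounded[of \<sigma>] arcsin_le_arcsin[of 0 \<sigma>] \<sigma> by (auto simp: \<theta>0_def)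
  have "\<sigma>\<^sup>2 \<le> (7/32)\<^sup>2" using \<sigma> by (intro power_mono) auto
  then have \<sigma>2: "\<sigma>\<^sup>2 \<le> 49/1024" by (simp add: power_divide)
  have cos_ge: "35/36 \<le> cos \<theta>" and sin_bd: "0 \<le> sin \<theta>" "sin \<theta> \<le> \<sigma>" if "0 \<le> \<theta>" "\<theta> \<le> \<theta>0" for \<theta>
  proof -
    show "0 \<le> sin \<theta>" using that b0 by (intro sin_ge_zero) auto
    show "sin \<theta> \<le> \<sigma>" unfolding sin0[symmetric] using that b0 by (intro sin_monotone_2pi_le) auto
    then have "(sin \<theta>)\<^sup>2 \<le> \<sigma>\<^sup>2" using \<open>0 \<le> sin \<theta>\<close> by (intro power_mono)
    then have "(35/36)\<^sup>2 \<le> (cos \<theta>)\<^sup>2" using \<sigma>2 by (simp add: cos_squared_eq power_divide)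
    then show "35/36 \<le> cos \<theta>"
      by (rule power2_le_imp_le) (use that b0 in \<open>auto intro!: cos_ge_zero\<close>)
  qed
  have "real N * cos \<theta>0 + sin \<theta>0 \<le> w"
  proof -
    have c0: "35/36 \<le> cos \<theta>0" using cos_ge b0 by auto
    have "cos \<theta>0 * cos \<theta>0 = 1 - \<sigma>\<^sup>2" using cos_squared_eq[of \<theta>0] sin0 by (simp add: power2_eq_square)
    moreover have "(1 - cos \<theta>0) * (1 - cos \<theta>0) \<ge> 0" by simp
    ultimately have "cos \<theta>0 \<le> 1 - \<sigma>\<^sup>2 / 2" by (simp add: algebra_simps)
    then have "real N * cos \<theta>0 \<le> real N * (1 - \<sigma>\<^sup>2 / 2)" by (intro mult_left_mono) auto
    moreover have "49/16 \<le> real N * \<sigma>\<^sup>2"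
    proof -
      have "u^6 * \<sigma>\<^sup>2 = 49/16" using u by (simp add: \<sigma>_def power_divide power_mult[symmetric])
      moreover have "u^6 * \<sigma>\<^sup>2 \<le> real N * \<sigma>\<^sup>2" using w by (intro mult_right_mono) auto
      ultimately show ?thesis by simp
    qed
    ultimately show ?thesis using w \<sigma> unfolding sin0 by (simp add: algebra_simps)
  qed
  moreover have "w \<le> real N * cos 0 + sin 0" using w by simp
  ultimately obtain \<theta> where \<theta>: "0 \<le> \<theta>" "\<theta> \<le> \<theta>0" "real N * cos \<theta> + sin \<theta> = w"
    using IVT2[of "\<lambda>\<theta>. real N * cos \<theta> + sin \<theta>" \<theta>0 w 0] b0 by (auto simp: continuous_intros)
  note c = cos_ge[OF \<theta>(1,2)] and s = sin_bd[OF \<theta>(1,2)]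
  have "sin \<theta> / cos \<theta> \<le> \<sigma> / (35/36)" using c s by (intro frac_le) auto
  then have "tan \<theta> \<le> 9/5 / u^3" by (simp add: tan_def \<sigma>_def)
  moreover have "0 \<le> tan \<theta>" unfolding tan_def using c s by simp
  ultimately show ?thesis using that \<theta> b0 c s by auto
qed

text \<open>The leaning columns are parallel, and each loses an area \<open>tan \<theta>\<close> in the saw teeth along the
  two edges of the strip. Left over at the two ends are right trapezoids with the same slant, the right one upside down.
  Their short sides have length at least \<open>5/4 * u\<^sup>2\<close>, as the trapezoid packing requires.\<close>
lemma strip_packing:
  fixes u w L :: real
  assumes u: "2 \<le> u" and w: "u^6 \<le> w" "w \<le> u^6 + 1" and L: "4 * u^3 \<le> L"
  shows "packable (rectangle 0 0 L w) (L * w - (9/5 * L / u^3 + 21 * u^5))"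
proof -
  have u2: "4 \<le> u\<^sup>2" and u3: "8 \<le> u^3" and u5: "32 \<le> u^5" and u6: "64 \<le> u^6"
    using power_mono[OF u, of 2] power_mono[OF u, of 3] power_mono[OF u, of 5] power_mono[OF u, of 6] by auto
  define N where "N = nat \<lceil>w\<rceil>"
  have N: "w \<le> real N" "real N < w + 1" using w u6 unfolding N_def by linarith+
  obtain \<theta> where \<theta>: "0 \<le> \<theta>" "\<theta> < pi / 2" "real N * cos \<theta> + sin \<theta> = w"
    "0 \<le> tan \<theta>" "tan \<theta> \<le> 9/5 / u^3" "35/36 \<le> cos \<theta>" "0 \<le> sin \<theta>"
    using leaning_column_angle[OF u w(1) N] by metis
  define s c \<tau> where "s = sin \<theta>" and "c = cos \<theta>" and "\<tau> = tan \<theta>"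
  have c: "35/36 \<le> c" "c \<le> 1" and s: "0 \<le> s" and \<tau>: "0 \<le> \<tau>" "\<tau> \<le> 9/5 / u^3" and c\<tau>: "c * \<tau> = s"
    and Nw: "real N * c + s = w"
    using \<theta> by (auto simp: s_def c_def \<tau>_def tan_def)
  have c0: "0 < c" using c by simp
  have sc: "c * c + s * s = 1" using sin_cos_squared_add3 by (simp add: s_def c_def)
  define a where "a = 5/4 * u\<^sup>2"
  define b where "b = a + w * \<tau>"
  have a0: "0 \<le> a" by (simp add: a_def)
  have w0: "0 \<le> w" using w u6 by linarith
  have au3: "2 * a \<le> 5/4 * u^3"
    using mult_right_mono[OF u, of "u\<^sup>2"] by (simp add: a_def eval_nat_numeral algebra_simps)
  have u35: "4 * u^3 \<le> u^5"
    using mult_right_mono[OF u2, of "u^3"] u3 by (simp add: eval_nat_numeral algebra_simps)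
  have w\<tau>: "w * \<tau> \<le> 9/5 * u^3 + 9/40"
  proof -
    have "w * \<tau> \<le> (u^6 + 1) * (9/5 / u^3)" using w w0 \<tau> by (intro mult_mono) auto
    also have "\<dots> = 9/5 * u^3 + 9/5 / u^3" using u by (simp add: field_simps eval_nat_numeral)
    also have "9/5 / u^3 \<le> 9/5 / 8" using u3 u by (intro divide_left_mono) auto
    finally show ?thesis by simp
  qed
  define n where "n = nat \<lfloor>(L - b - a) * c\<rfloor>"
  have "0 \<le> L - b - a" using L au3 w\<tau> u3 unfolding b_def by linarith
  then have "0 \<le> (L - b - a) * c" using c0 by simp
  then have n: "real n \<le> (L - b - a) * c" "(L - b - a) * c < real n + 1"
    unfolding n_def by linarith+
  define a' where "a' = L - b - real n / c"
  have a': "a \<le> a'" "a' \<le> a + 36/35"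
  proof -
    show "a \<le> a'" using n(1) c0 by (simp add: a'_def pos_divide_le_eq[symmetric] le_diff_eq algebra_simps) (simp add: field_simps)
    have "L - b - a \<le> (real n + 1) / c" using n(2) c0 by (simp add: pos_le_divide_eq)
    moreover have "1 / c \<le> 36/35" using c c0 by (simp add: field_simps)
    ultimately show "a' \<le> a + 36/35" by (simp add: a'_def add_divide_distrib)
  qed
  have "9/5 / u^3 \<le> 2 / u^3" using u by (intro divide_right_mono) auto
  then have \<tau>2: "tan \<theta> \<le> 2 / u^3" using \<theta>(5) by linarith
  define left where "left = right_trapezoid 0 a w \<theta>"
  define right where "right = motion (pt L w) pi ` right_trapezoid 0 a' w \<theta>"
  define mid where "mid = {z::real^2. 0 \<le> z$2 \<and> z$2 \<le> w \<and> b \<le> z$1 + z$2 * \<tau> \<and> z$1 + z$2 * \<tau> \<le> b + real n / c}"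
  define lm where "lm = {z::real^2. 0 \<le> z$2 \<and> z$2 \<le> w \<and> 0 \<le> z$1 \<and> z$1 + z$2 * \<tau> \<le> b + real n / c}"
  have P_left: "packable left (a * w + w\<^sup>2 * \<tau> / 2 - (10 * u^5 + a))"
    unfolding left_def \<tau>_def using trapezoid_packing[OF u w \<theta>(4) \<tau>2, of a] by (simp add: a_def)
  have P_right: "packable right (a' * w + w\<^sup>2 * \<tau> / 2 - (10 * u^5 + a'))"
    unfolding right_def \<tau>_def by (rule packable_motion, rule trapezoid_packing[OF u w \<theta>(4) \<tau>2])
      (use a' in \<open>simp add: a_def\<close>)
  define bar where "bar = (\<lambda>k. rectangle (pt (b + real k / c) 0) \<theta> (real 1) (real N))"
  have bar: "0 \<le> z$2" "z$2 \<le> w" "b + real k / c \<le> z$1 + z$2 * \<tau>" "z$1 + z$2 * \<tau> \<le> b + (real k + 1) / c"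
    if z: "z \<in> bar k" for z k
  proof -
    define x where "x = z$1 - (b + real k / c)"
    define y where "y = z$2"
    have *: "0 \<le> x * c + y * s" "x * c + y * s \<le> 1" "0 \<le> y * c - x * s" "y * c - x * s \<le> real N"
      using z unfolding bar_def mem_rectangle x_def y_def s_def c_def by auto
    have y: "y = s * (x * c + y * s) + c * (y * c - x * s)" using sc by algebra
    have "0 \<le> s * (x * c + y * s)" "0 \<le> c * (y * c - x * s)" using * s c0 by auto
    moreover have "s * (x * c + y * s) \<le> s * 1" "c * (y * c - x * s) \<le> c * real N"
      using * s c0 by (auto intro!: mult_left_mono simp del: mult_1_right)
    ultimately have "0 \<le> y" "y \<le> w" using y Nw by (linarith, simp add: mult.commute)
    then show "0 \<le> z$2" "z$2 \<le> w" by (simp_all add: y_def)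
    have xy: "x * c + y * s = c * (x + y * \<tau>)" unfolding c\<tau>[symmetric] by (simp add: algebra_simps)
    have "0 \<le> x + y * \<tau>" using *(1) c0 unfolding xy by (simp add: zero_le_mult_iff)
    then show "b + real k / c \<le> z$1 + z$2 * \<tau>" by (simp add: x_def y_def)
    have "x + y * \<tau> \<le> 1 / c" using *(2) c0 unfolding xy by (simp add: pos_le_divide_eq mult.commute)
    then show "z$1 + z$2 * \<tau> \<le> b + (real k + 1) / c" by (simp add: x_def y_def add_divide_distrib)
  qed
  have kc: "(real k + 1) / c \<le> real l / c" if "k < l" for k l
    using that c0 by (intro divide_right_mono) auto
  have P_mid: "packable mid (\<Sum>k<n. real 1 * real N)"
  proof (rule packable_family[where A = bar])
    show "packable (bar k) (real 1 * real N)" for k unfolding bar_def by (rule packable_grid)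
    show "bar k \<subseteq> mid" if "k \<in> {..<n}" for k
    proof
      fix z assume z: "z \<in> bar k"
      have "0 \<le> real k / c" using c0 by simp
      then show "z \<in> mid" unfolding mid_def using bar[OF z] kc[of k n] that by auto
    qed
    have less: "interior (bar k) \<inter> interior (bar l) = {}" if "k < l" for k l
    proof (rule interiors_separated[where \<alpha> = 1 and \<beta> = \<tau> and \<gamma> = "b + real l / c"])
      show "1 * z$1 + \<tau> * z$2 \<le> b + real l / c" if "z \<in> bar k" for z
        using bar(4)[OF that] kc[OF \<open>k < l\<close>] by (simp add: mult.commute)
      show "b + real l / c \<le> 1 * z$1 + \<tau> * z$2" if "z \<in> bar l" for z
        using bar(3)[OF that] by (simp add: mult.commute)
    qed simp
    show "interior (bar k) \<inter> interior (bar l) = {}" if "k \<noteq> l" for k l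
      using less[of k l] less[of l k] that by (metis Int_commute linorder_neqE_nat)
  qed simp
  have left: "0 \<le> z$2" "z$2 \<le> w" "0 \<le> z$1" "z$1 + z$2 * \<tau> \<le> b" if "z \<in> left" for z
    using that unfolding left_def mem_right_trapezoid b_def \<tau>_def by (auto simp: algebra_simps)
  have right: "0 \<le> z$2" "z$2 \<le> w" "z$1 \<le> L" "b + real n / c \<le> z$1 + z$2 * \<tau>" if "z \<in> right" for z
    using that unfolding right_def \<tau>_def by (auto simp: mem_right_trapezoid motion_def a'_def algebra_simps)
  have y\<tau>: "z$2 * \<tau> \<le> w * \<tau>" if "z$2 \<le> w" for z :: "real^2" using that \<tau> by (intro mult_right_mono)
  have nc: "0 \<le> real n / c" using c0 by simp
  have P_lm: "packable lm (a * w + w\<^sup>2 * \<tau> / 2 - (10 * u^5 + a) + (\<Sum>k<n. real 1 * real N))"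
  proof (rule packable_union[OF P_left P_mid])
    show "left \<subseteq> lm" using left nc unfolding lm_def by force
    show "mid \<subseteq> lm"
    proof
      fix z assume "z \<in> mid"
      then show "z \<in> lm" using y\<tau>[of z] a0 unfolding mid_def lm_def b_def by auto
    qed
    show "interior left \<inter> interior mid = {}"
    proof (rule interiors_separated[where \<alpha> = 1 and \<beta> = \<tau> and \<gamma> = b])
      show "1 * z$1 + \<tau> * z$2 \<le> b" if "z \<in> left" for z using left(4)[OF that] by (simp add: mult.commute)
      show "b \<le> 1 * z$1 + \<tau> * z$2" if "z \<in> mid" for z using that by (simp add: mid_def mult.commute)
    qed simp
  qed
  have "packable (rectangle 0 0 L w)
     ((a * w + w\<^sup>2 * \<tau> / 2 - (10 * u^5 + a) + (\<Sum>k<n. real 1 * real N))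
      + (a' * w + w\<^sup>2 * \<tau> / 2 - (10 * u^5 + a')))"
  proof (rule packable_union[OF P_lm P_right])
    show "lm \<subseteq> rectangle 0 0 L w"
    proof
      fix z assume z: "z \<in> lm"
      then have "0 \<le> z$2 * \<tau>" using \<tau> by (simp add: lm_def)
      then show "z \<in> rectangle 0 0 L w" using z a' a0 unfolding lm_def mem_rectangle a'_def by auto
    qed
    show "right \<subseteq> rectangle 0 0 L w"
    proof
      fix z assume z: "z \<in> right"
      have "0 \<le> z$1" using right[OF z] y\<tau>[of z] a0 nc unfolding b_def by linarith
      then show "z \<in> rectangle 0 0 L w" using right[OF z] unfolding mem_rectangle by auto
    qed
    show "interior lm \<inter> interior right = {}"
    proof (rule interiors_separated[where \<alpha> = 1 and \<beta> = \<tau> and \<gamma> = "b + real n / c"])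
      show "1 * z$1 + \<tau> * z$2 \<le> b + real n / c" if "z \<in> lm" for z using that by (simp add: lm_def mult.commute)
      show "b + real n / c \<le> 1 * z$1 + \<tau> * z$2" if "z \<in> right" for z
        using right(4)[OF that] by (simp add: mult.commute)
    qed simp
  qed
  then show ?thesis
  proof (rule packable_mono)
    have "real n / c * w = real n * real N + real n * \<tau>"
      unfolding Nw[symmetric] c\<tau>[symmetric] using c0 by (simp add: field_simps)
    moreover have "L = a + w * \<tau> + real n / c + a'" by (simp add: a'_def b_def)
    then have "L * w = a * w + w\<^sup>2 * \<tau> + real n / c * w + a' * w"
      by (simp add: algebra_simps power2_eq_square)
    moreover have "real n * \<tau> \<le> 9/5 * L / u^3"
    proof -
      have "0 \<le> b" using a0 w0 \<tau> by (simp add: b_def)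
      moreover have "(L - b - a) * c \<le> (L - b - a) * 1"
        using c \<open>0 \<le> L - b - a\<close> by (intro mult_left_mono) auto
      ultimately have "real n \<le> L" using n(1) a0 by simp
      then have "real n * \<tau> \<le> L * (9/5 / u^3)" using \<tau> by (intro mult_mono) auto
      then show ?thesis by (simp add: mult.commute)
    qed
    moreover have "(\<Sum>k<n. real 1 * real N) = real n * real N" by simp
    ultimately show "L * w - (9/5 * L / u^3 + 21 * u^5)
      \<le> (a * w + w\<^sup>2 * \<tau> / 2 - (10 * u^5 + a) + (\<Sum>k<n. real 1 * real N))
      + (a' * w + w\<^sup>2 * \<tau> / 2 - (10 * u^5 + a'))"
      using a' au3 u35 u5 by linarith
  qed simp
qed

section \<open>Waste of rectangles and squares\<close>

lemma packing_waste_rectangle_le: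
  assumes "packable (rectangle 0 0 l w) r" "0 \<le> l" "0 \<le> w"
  shows "packing_waste (rectangle p t l w) \<le> l * w - r"
proof -
  have "rectangle p t l w = motion p t ` rectangle 0 0 l w"
    unfolding motion_rectangle by (simp add: motion_0)
  then have "packable (rectangle p t l w) r" using assms packable_motion by metis
  then show ?thesis
    using packing_waste_le[OF _ lmeasurable_rectangle] assms area_rectangle[of l w p t] by metis
qed

lemma packing_waste_right_trapezoid_le:
  assumes "packable (right_trapezoid 0 a h \<theta>) (a * h + h\<^sup>2 * tan \<theta> / 2 - E)"
    and "0 \<le> a" "0 \<le> h" "0 \<le> tan \<theta>"
  shows "packing_waste (right_trapezoid p a h \<theta>) \<le> E"
  using packing_waste_le[OF packable_right_trapezoid_translate[OF assms(1)]
      lmeasurable_right_trapezoid[OF assms(2-4)], of p]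
    area_right_trapezoid_le[OF assms(2-4), of p] by linarith

text \<open>With \<open>u = x powr (1/8)\<close>, the strips along the bottom and along the right side have a thickness between
  \<open>u^6\<close> and \<open>u^6 + 1\<close>, chosen so that the remaining rectangle has integer sides. Each strip
  of length \<open>L\<close> loses at most \<open>9/5 * L / u^3 + 21 * u^5\<close>, which is \<open>O(u^5)\<close> because \<open>L = O(u^8)\<close>. If the second
  strip is too short for leaning columns, filling it with upright rows loses at most its length, which is less than
  \<open>4 * u^3\<close>. For \<open>u \<le> 2\<close> the upright grid is good enough, because it loses at most the sum of two adjacent sides.\<close>
lemma rectangle_waste:
  fixes c x x' :: real
  assumes c: "c \<le> 7" and x: "0 < x" and x': "x powr (3/4) \<le> x'" "x' \<le> c * x"
  shows "packing_waste (rectangle p t x x') \<le> ((15 + c) * sqrt 2 + 38) * x powr (5/8)"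
proof -
  define u where "u = x powr (1/8)"
  have u0: "0 < u" using x by (simp add: u_def)
  have pw: "u ^ n = x powr (real n / 8)" for n
    unfolding u_def using x by (simp add: powr_realpow[symmetric] powr_powr)
  have u8: "x = u^8" and u6: "x powr (3/4) = u^6" and u5: "x powr (5/8) = u^5"
    using pw[of 8] pw[of 6] pw[of 5] x by auto
  have x'0: "0 < x'" using x'(1) u0 unfolding u6 by (smt (verit) zero_less_power)
  have c0: "0 < c" using x'0 x'(2) x by (smt (verit) zero_less_mult_pos2 mult_nonpos_nonneg)
  have s2: "1.414 \<le> sqrt 2" by (rule real_le_rsqrt) (simp add: power2_eq_square)
  have "1.414 * (15 + c) \<le> sqrt 2 * (15 + c)" using s2 c0 by (intro mult_right_mono) auto
  then have const: "438/10 + 9/5 * c \<le> (15 + c) * sqrt 2 + 38" "8 + 8 * c \<le> (15 + c) * sqrt 2 + 38"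
    using c c0 by (simp_all add: algebra_simps)
  have x5: "0 \<le> u^5" using u0 by simp
  have "\<exists>r. packable (rectangle 0 0 x x') r \<and> x * x' - r \<le> ((15 + c) * sqrt 2 + 38) * u^5"
  proof (cases "u \<le> 2")
    case True
    let ?r = "real (nat \<lfloor>x\<rfloor>) * real (nat \<lfloor>x'\<rfloor>)"
    have "packable (rectangle 0 0 x x') ?r"
      by (rule packable_rectangle_grid) (use x x'0 in linarith)+
    moreover have "x * x' - ?r \<le> x + x'" using floor_grid_waste[of x x'] x x'0 by linarith
    moreover have "u^8 \<le> 8 * u^5"
    proof -
      have "u^3 \<le> 8" using power_mono[OF True, of 3] u0 by simp
      then have "u^3 * u^5 \<le> 8 * u^5" using x5 by (intro mult_right_mono)
      then show ?thesis by (simp add: eval_nat_numeral)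
    qed
    then have "(1 + c) * x \<le> (1 + c) * (8 * u^5)" unfolding u8 using c0 by (intro mult_left_mono) auto
    then have "(1 + c) * x \<le> (8 + 8 * c) * u^5" by (simp add: algebra_simps)
    moreover have "(8 + 8 * c) * u^5 \<le> ((15 + c) * sqrt 2 + 38) * u^5"
      using const x5 by (intro mult_right_mono)
    moreover have "x + x' \<le> (1 + c) * x" using x' by (simp add: algebra_simps)
    ultimately have "packable (rectangle 0 0 x x') ?r" "x * x' - ?r \<le> ((15 + c) * sqrt 2 + 38) * u^5"
      by linarith+
    then show ?thesis by blast
  next
    case False
    then have u2: "2 \<le> u" by simp
    have p: "4 \<le> u\<^sup>2" "8 \<le> u^3" "32 \<le> u^5"
      using power_mono[OF u2, of 2] power_mono[OF u2, of 3] power_mono[OF u2, of 5] by auto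
    have "4 * u^3 \<le> u\<^sup>2 * u^3" using p u0 by (intro mult_right_mono) auto
    then have u35: "4 * u^3 \<le> u^5" by (simp add: eval_nat_numeral)
    have "u^3 * 8 \<le> u^3 * u^5" using p u0 by (intro mult_left_mono) auto
    then have u38: "4 * u^3 \<le> u^8" using p by (simp add: power_add[symmetric])
    have "u^6 * 1 \<le> u^6 * u\<^sup>2" using p u0 by (intro mult_left_mono) auto
    then have u68: "u^6 \<le> u^8" by (simp add: power_add[symmetric])
    define m where "m = nat \<lfloor>x' - u^6\<rfloor>"
    define q where "q = nat \<lfloor>x - u^6\<rfloor>"
    define w where "w = x' - real m"
    define w2 where "w2 = x - real q"
    have w: "u^6 \<le> w" "w \<le> u^6 + 1" using x'(1) unfolding u6 w_def m_def by linarith+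
    have w2: "u^6 \<le> w2" "w2 \<le> u^6 + 1" using u68 u8 unfolding w2_def q_def by linarith+
    have w0: "0 \<le> w" "0 \<le> w2" using w w2 u0 by (smt (verit) zero_less_power)+
    have P1: "packable (rectangle 0 0 x w) (x * w - (9/5 * x / u^3 + 21 * u^5))"
      by (rule strip_packing[OF u2 w]) (use u38 u8 in simp)
    have P2: "packable (rectangle (pt 0 w) 0 (real q) (real m)) (real q * real m)" by (rule packable_grid)
    have P3: "packable (rectangle 0 0 (real m) w2) (real m * w2 - (9/5 * c + 21) * u^5)"
    proof (cases "4 * u^3 \<le> real m")
      case True
      have "9/5 * real m / u^3 \<le> 9/5 * c * u^5"
      proof -
        have "real m \<le> c * u^8" using x'(2) w0 unfolding w_def u8[symmetric] by linarith
        then have "9/5 * real m / u^3 \<le> 9/5 * (c * u^8) / u^3" using u0 by (intro divide_right_mono) auto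
        also have "\<dots> = 9/5 * c * u^5" using u0 by (simp add: field_simps power_add[symmetric])
        finally show ?thesis .
      qed
      then show ?thesis
        by (intro packable_mono[OF strip_packing[OF u2 w2 True]]) (auto simp: algebra_simps)
    next
      case False
      have "real m * w2 - real m * real (nat \<lfloor>w2\<rfloor>) = real m * (w2 - real (nat \<lfloor>w2\<rfloor>))" by (simp add: algebra_simps)
      also have "\<dots> \<le> real m * 1" by (rule mult_left_mono) (use w0 in linarith)+
      also have "\<dots> \<le> 21 * u^5" using False u35 p by simp
      also have "\<dots> \<le> (9/5 * c + 21) * u^5" using c0 x5 by (intro mult_right_mono) auto
      finally have "real m * w2 - (9/5 * c + 21) * u^5 \<le> real m * real (nat \<lfloor>w2\<rfloor>)" by linarith
      moreover have "packable (rectangle 0 0 (real m) w2) (real m * real (nat \<lfloor>w2\<rfloor>))"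
        by (rule packable_rectangle_grid) (use w0 in linarith)+
      ultimately show ?thesis using packable_mono by blast
    qed
    define R where "R = motion (pt x w) (pi/2) ` rectangle 0 0 (real m) w2"
    have R: "R = {z. w \<le> z$2 \<and> z$2 \<le> x' \<and> real q \<le> z$1 \<and> z$1 \<le> x}"
      unfolding R_def motion_rectangle
      by (auto simp: mem_rectangle motion_0 w_def w2_def)
    have P3': "packable R (real m * w2 - (9/5 * c + 21) * u^5)"
      unfolding R_def by (rule packable_motion[OF P3])
    have "packable (rectangle (pt 0 w) 0 x (real m)) (real q * real m + (real m * w2 - (9/5 * c + 21) * u^5))"
    proof (rule packable_union[OF P2 P3'])
      show "rectangle (pt 0 w) 0 (real q) (real m) \<subseteq> rectangle (pt 0 w) 0 x (real m)"
        using w0 by (auto simp: mem_rectangle w2_def)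
      show "R \<subseteq> rectangle (pt 0 w) 0 x (real m)"
        unfolding R by (auto simp: mem_rectangle w_def)
      show "interior (rectangle (pt 0 w) 0 (real q) (real m)) \<inter> interior R = {}"
        by (rule interiors_separated[where \<alpha>=1 and \<beta>=0 and \<gamma>="real q"]) (auto simp: R mem_rectangle)
    qed
    then have "packable (rectangle 0 0 x x') (x * w - (9/5 * x / u^3 + 21 * u^5)
        + (real q * real m + (real m * w2 - (9/5 * c + 21) * u^5)))"
    proof (rule packable_union[OF P1])
      show "rectangle 0 0 x w \<subseteq> rectangle 0 0 x x'" by (auto simp: mem_rectangle w_def)
      show "rectangle (pt 0 w) 0 x (real m) \<subseteq> rectangle 0 0 x x'"
        using w0 by (auto simp: mem_rectangle w_def)
      show "interior (rectangle 0 0 x w) \<inter> interior (rectangle (pt 0 w) 0 x (real m)) = {}"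
        by (rule interiors_separated[where \<alpha>=0 and \<beta>=1 and \<gamma>=w]) (auto simp: mem_rectangle)
    qed
    moreover have "x * x' - (x * w - (9/5 * x / u^3 + 21 * u^5)
        + (real q * real m + (real m * w2 - (9/5 * c + 21) * u^5))) = (438/10 + 9/5 * c) * u^5"
    proof -
      have "9/5 * x / u^3 = 9/5 * u^5" unfolding u8 using u0 by (simp add: field_simps power_add[symmetric])
      moreover have "x * x' = x * w + real q * real m + real m * w2"
        by (simp add: w_def w2_def algebra_simps)
      ultimately show ?thesis by (simp add: algebra_simps)
    qed
    moreover have "(438/10 + 9/5 * c) * u^5 \<le> ((15 + c) * sqrt 2 + 38) * u^5"
      using const x5 by (intro mult_right_mono)
    ultimately show ?thesis by metis
  qed
  then obtain r where "packable (rectangle 0 0 x x') r" "x * x' - r \<le> ((15 + c) * sqrt 2 + 38) * u^5" by blast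
  then show ?thesis
    using packing_waste_rectangle_le[of x x' r p t] x x'0 unfolding u5 by linarith
qed

text \<open>For \<open>x < 1\<close> the bound exceeds the area of the square.\<close>
lemma square_waste:
  assumes x: "0 < x"
  shows "packing_waste (rectangle p t x x) \<le> (16 * sqrt 2 + 38) * x powr (5/8)"
proof (cases "1 \<le> x")
  case True
  then have "x powr (3/4) \<le> x powr 1" by (intro powr_mono) auto
  then show ?thesis using rectangle_waste[of 1 x x p t] x by simp
next
  case False
  have "x * x \<le> x powr (5/8)"
  proof -
    have "x powr 2 \<le> x powr (5/8)" using False x by (intro powr_mono') auto
    then show ?thesis using x by (simp add: power2_eq_square)
  qed
  also have "\<dots> \<le> (16 * sqrt 2 + 38) * x powr (5/8)"
  proof -
    have "1 * x powr (5/8) \<le> (16 * sqrt 2 + 38) * x powr (5/8)" by (intro mult_right_mono) auto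
    then show ?thesis by simp
  qed
  finally show ?thesis
    using packing_waste_rectangle_le[OF packable_empty, of 0 x x p t] x by simp
qed

section \<open>Trapezoids with asymptotically given sides\<close>

lemma eventually_ratio_bounds:
  assumes "f \<sim>[at_top] g" "\<forall>\<^sub>F x in at_top. 0 < g x" "0 < e"
  shows "\<forall>\<^sub>F x::real in at_top. (1 - e) * g x \<le> f x \<and> f x \<le> (1 + e) * (g x :: real)"
proof -
  have "((\<lambda>x. if f x = 0 \<and> g x = 0 then 1 else f x / g x) \<longlongrightarrow> 1) at_top"
    using assms(1) by (rule asymp_equivD)
  then have "\<forall>\<^sub>F x in at_top. dist (if f x = 0 \<and> g x = 0 then 1 else f x / g x) 1 < e"
    using assms(3) by (rule tendstoD)
  then show ?thesis using assms(2)
  proof eventually_elim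
    case (elim x)
    then have "\<bar>f x / g x - 1\<bar> < e" by (simp add: dist_real_def)
    then have "1 - e \<le> f x / g x" "f x / g x \<le> 1 + e" by linarith+
    then show ?case using elim(2) by (simp add: pos_le_divide_eq pos_divide_le_eq)
  qed
qed

lemma tan_le_of_small_angle:
  fixes u \<theta> :: real
  assumes "8 \<le> u" "0 < \<theta>" "\<theta> < sqrt 2 / u^3"
  shows "0 \<le> tan \<theta>" "tan \<theta> \<le> 3/2 / u^3"
proof -
  have u3: "512 \<le> u^3" using power_mono[of 8 u 3] assms by simp
  have s2: "sqrt 2 \<le> 1.4143" by (rule real_le_lsqrt) (simp_all add: power2_eq_square)
  have "sqrt 2 / u^3 \<le> 1.4143 / u^3" using s2 assms(1) by (intro divide_right_mono) auto
  then have t: "\<theta> \<le> 1.4143 / u^3" using assms by linarith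
  also have "\<dots> \<le> 1.4143 / 512" using u3 assms(1) by (intro divide_left_mono) auto
  finally have "\<theta> \<le> 1/4" by simp
  note sm = small_angle[OF assms(2) this]
  show "0 \<le> tan \<theta>" using sm by simp
  have "26/25 * \<theta> \<le> 26/25 * (1.4143 / u^3)" using t by (intro mult_left_mono) auto
  also have "\<dots> = (26/25 * 1.4143) / u^3" by simp
  also have "\<dots> \<le> 3/2 / u^3" using assms(1) by (intro divide_right_mono) auto
  finally show "tan \<theta> \<le> 3/2 / u^3" using sm(9) by linarith
qed

lemma sixth_root_powers:
  fixes x :: real
  assumes "8^6 \<le> x"
  shows "8 \<le> x powr (1/6)" "x = (x powr (1/6))^6" "x powr (1/2) = (x powr (1/6))^3"
    "x powr (-1/2) = 1 / (x powr (1/6))^3" "x powr (5/6) = (x powr (1/6))^5" "x powr (1/3) = (x powr (1/6))\<^sup>2"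
proof -
  have x: "0 < x" using assms by (smt (verit) zero_less_power)
  have pw: "(x powr (1/6)) ^ n = x powr (real n / 6)" for n
    using x by (simp add: powr_realpow[symmetric] powr_powr)
  show x6: "x = (x powr (1/6))^6" unfolding pw using x by auto
  have "8 ^ Suc 5 \<le> (x powr (1/6)) ^ Suc 5" using assms x6 by simp
  then show "8 \<le> x powr (1/6)" by (rule power_le_imp_le_base) simp
  show "x powr (1/2) = (x powr (1/6))^3"
    "x powr (5/6) = (x powr (1/6))^5" "x powr (1/3) = (x powr (1/6))\<^sup>2"
    unfolding pw using x by auto
  show "x powr (-1/2) = 1 / (x powr (1/6))^3" unfolding pw using x by (simp add: powr_minus_divide[symmetric])
qed

text \<open>Eventually \<open>x' x\<close> is at least \<open>5/4 * x powr (1/3)\<close>, and \<open>x' x = O(x powr (1/2))\<close> is negligible against the main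
  term.\<close>
lemma tall_trapezoid_waste:
  fixes x' \<theta> :: "real \<Rightarrow> real"
  assumes x': "x' \<sim>[at_top] (\<lambda>x. 2 * x powr (1/2))"
    and \<theta>: "\<forall>\<^sub>F x in at_top. 0 < \<theta> x \<and> \<theta> x < sqrt 2 * x powr (-1/2)"
  shows "\<forall>\<^sub>F x in at_top. \<forall>p. packing_waste (right_trapezoid p (x' x) x (\<theta> x))
             \<le> (19/2 + 7/2 * sqrt 2) * x powr (5/6)"
proof -
  have "\<forall>\<^sub>F x in at_top. (1 - 1/4) * (2 * x powr (1/2)) \<le> x' x \<and> x' x \<le> (1 + 1/4) * (2 * x powr (1/2))"
    by (rule eventually_ratio_bounds[OF x'])
       (auto intro: eventually_mono[OF eventually_gt_at_top[of 0]])
  moreover have "\<forall>\<^sub>F x::real in at_top. 8^6 \<le> x" by (rule eventually_ge_at_top)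
  ultimately show ?thesis using \<theta>
  proof eventually_elim
    case (elim x)
    define u where "u = x powr (1/6)"
    note r = sixth_root_powers[OF elim(2), folded u_def]
    have a: "3/2 * u^3 \<le> x' x" "x' x \<le> 5/2 * u^3" using elim(1) unfolding r(3) by auto
    have u2: "64 \<le> u\<^sup>2" using power_mono[of 8 u 2] r(1) by simp
    have u3: "0 \<le> u^3" using r(1) by simp
    have "8 * u\<^sup>2 \<le> u * u\<^sup>2" using r(1) by (intro mult_right_mono) auto
    moreover have "u * u\<^sup>2 = u^3" by (simp add: eval_nat_numeral)
    ultimately have "5/4 * u\<^sup>2 \<le> u^3" using u2 by linarith
    then have a2: "5/4 * u\<^sup>2 \<le> x' x" using a u3 by linarith
    have t: "0 \<le> tan (\<theta> x)" "tan (\<theta> x) \<le> 3/2 / u^3"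
      using tan_le_of_small_angle[OF r(1), of "\<theta> x"] elim(3) unfolding r(4) by auto
    have "3/2 / u^3 \<le> 2 / u^3" using r(1) by (intro divide_right_mono) auto
    then have t2: "tan (\<theta> x) \<le> 2 / u^3" using t by linarith
    have "0 \<le> (8::real)^6" by simp
    then have x0: "0 \<le> x" "0 \<le> x' x" using elim(2) a2 u2 by linarith+
    have "packable (right_trapezoid 0 (x' x) x (\<theta> x))
       (x' x * x + x\<^sup>2 * tan (\<theta> x) / 2 - (10 * u^5 + x' x))"
      by (rule trapezoid_packing) (use r t t2 a2 in auto)
    then have "packing_waste (right_trapezoid p (x' x) x (\<theta> x)) \<le> 10 * u^5 + x' x" for p
      by (rule packing_waste_right_trapezoid_le) (use x0 t in auto)
    moreover have "10 * u^5 + x' x \<le> (19/2 + 7/2 * sqrt 2) * u^5"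
    proof -
      have "64 * u^3 \<le> u\<^sup>2 * u^3" using u2 u3 by (intro mult_right_mono)
      moreover have "u\<^sup>2 * u^3 = u^5" by (simp add: eval_nat_numeral)
      ultimately have "5/2 * u^3 \<le> u^5" using u3 by linarith
      moreover have "11 * u^5 \<le> (19/2 + 7/2 * sqrt 2) * u^5"
      proof (rule mult_right_mono)
        have "1 \<le> sqrt 2" by simp
        then show "11 \<le> 19/2 + 7/2 * sqrt 2" by linarith
      qed (use r in simp)
      ultimately show ?thesis using a by linarith
    qed
    ultimately show ?case unfolding r(5) by (meson order_trans)
  qed
qed

text \<open>A single layer suffices, because the width changes by less than 1 over the height \<open>h x\<close>. The angle
  \<open>3 / x powr (1/6)\<close> is large enough for the tilted rows to fit into the top edge.\<close>
lemma short_trapezoid_waste: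
  fixes h \<theta> :: "real \<Rightarrow> real"
  assumes h: "h \<sim>[at_top] (\<lambda>x. 1/2 * x powr (1/2))"
    and \<theta>: "\<forall>\<^sub>F x in at_top. 0 < \<theta> x \<and> \<theta> x < sqrt 2 * x powr (-1/2)"
  shows "\<forall>\<^sub>F x in at_top. \<forall>p. packing_waste
             (right_trapezoid p (real_of_int \<lfloor>x powr (1/3) + sqrt 2 * x powr (1/6)\<rfloor>) (h x) (\<theta> x))
             \<le> (19/4 + 7/4 * sqrt 2) * x powr (1/3)"
proof -
  have "\<forall>\<^sub>F x in at_top. (1 - 1/50) * (1/2 * x powr (1/2)) \<le> h x \<and> h x \<le> (1 + 1/50) * (1/2 * x powr (1/2))"
    by (rule eventually_ratio_bounds[OF h])
       (auto intro: eventually_mono[OF eventually_gt_at_top[of 0]])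
  moreover have "\<forall>\<^sub>F x::real in at_top. 12^6 \<le> x" by (rule eventually_ge_at_top)
  ultimately show ?thesis using \<theta>
  proof eventually_elim
    case (elim x)
    define u where "u = x powr (1/6)"
    have "(8::real)^6 \<le> 12^6" by simp
    then have "8^6 \<le> x" using elim(2) by linarith
    note r = sixth_root_powers[OF this, folded u_def]
    have u12: "12 \<le> u"
      using elim(2) r(1) by (intro power_le_imp_le_base[of 12 5 u]) (auto simp: r(2)[symmetric])
    have hb: "49/100 * u^3 \<le> h x" "h x \<le> 51/100 * u^3" using elim(1) unfolding r(3) by auto
    have u3: "1728 \<le> u^3" using power_mono[of 12 u 3] u12 by simp
    have u2: "12 * u \<le> u\<^sup>2" using u12 by (simp add: power2_eq_square)
    define a where "a = real_of_int \<lfloor>x powr (1/3) + sqrt 2 * x powr (1/6)\<rfloor>"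
    have s2: "1 \<le> sqrt 2" "sqrt 2 \<le> 3/2" by (simp, rule real_le_lsqrt) (simp_all add: power2_eq_square)
    have a_eq: "a = real_of_int \<lfloor>u\<^sup>2 + sqrt 2 * u\<rfloor>" unfolding a_def r(6) u_def[symmetric] ..
    have "1 * u \<le> sqrt 2 * u" "sqrt 2 * u \<le> 3/2 * u" using s2 u12 by (intro mult_right_mono; simp)+
    then have a: "u\<^sup>2 \<le> a" "a \<le> u\<^sup>2 + 3/2 * u" using u12 unfolding a_eq by linarith+
    have t: "0 \<le> tan (\<theta> x)" "tan (\<theta> x) \<le> 3/2 / u^3"
      using tan_le_of_small_angle[OF r(1), of "\<theta> x"] elim(3) unfolding r(4) by auto
    define \<phi> where "\<phi> = 3 / u"
    define H where "H = nat \<lfloor>h x\<rfloor>"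
    define E where "E = 5/4 * \<phi> * real H + 14 / \<phi>\<^sup>2"
    have h0: "0 \<le> h x" using hb u3 by linarith
    have H: "real H \<le> h x" "h x \<le> real H + 1" using h0 unfolding H_def by linarith+
    have "real H * tan (\<theta> x) \<le> 51/100 * u^3 * (3/2 / u^3)"
      using H hb t u12 by (intro mult_mono) auto
    then have Ht: "real H * tan (\<theta> x) \<le> 1" using u12 by auto
    have "3/2 / u^3 \<le> 3/2 / 1728" using u3 u12 by (intro divide_left_mono) auto
    then have t1: "tan (\<theta> x) \<le> 1" using t by linarith
    have a0: "0 \<le> a" using a(1) by (smt (verit) zero_le_power2)
    have "packable (right_trapezoid 0 a (h x) (\<theta> x))
       (a * h x + (h x)\<^sup>2 * tan (\<theta> x) / 2 - (real 1 * E + 2 * (h x - real H) + a))"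
    proof (rule packable_trapezoid_layers)
      fix l assume l: "a \<le> l"
      show "packable (right_trapezoid 0 l (real H) (\<theta> x)) (l * real H + (real H)\<^sup>2 * tan (\<theta> x) / 2 - E)"
        unfolding E_def
      proof (rule trapezoid_layer)
        have "5 / \<phi>\<^sup>2 = 5/9 * u\<^sup>2" by (simp add: \<phi>_def power_divide)
        also have "\<dots> \<le> u\<^sup>2" by simp
        finally show "5 / \<phi>\<^sup>2 \<le> l" using a l by linarith
      qed (use u12 t Ht in \<open>auto simp: \<phi>_def field_simps\<close>)
    next
      show "(h x - real H) * tan (\<theta> x) \<le> 1" using H t t1 by (intro mult_le_one) auto
    qed (use t a0 H in auto)
    then have "packing_waste (right_trapezoid p a (h x) (\<theta> x)) \<le> real 1 * E + 2 * (h x - real H) + a" for p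
      by (rule packing_waste_right_trapezoid_le) (use a0 h0 t in auto)
    moreover have "real 1 * E + 2 * (h x - real H) + a \<le> (19/4 + 7/4 * sqrt 2) * u\<^sup>2"
    proof -
      have "5/4 * \<phi> * real H \<le> 5/4 * \<phi> * (51/100 * u^3)"
        using H hb u12 by (intro mult_left_mono) (auto simp: \<phi>_def)
      also have "\<dots> = 765/400 * u\<^sup>2" using u12 by (simp add: \<phi>_def eval_nat_numeral)
      finally have "5/4 * \<phi> * real H \<le> 765/400 * u\<^sup>2" .
      moreover have "14 / \<phi>\<^sup>2 = 14/9 * u\<^sup>2" by (simp add: \<phi>_def power_divide)
      ultimately have "E \<le> 765/400 * u\<^sup>2 + 14/9 * u\<^sup>2" unfolding E_def by linarith
      moreover have "2 * (h x - real H) \<le> 2" using H by simp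
      ultimately have "E + 2 * (h x - real H) + a \<le> 5 * u\<^sup>2" using a u2 u12 by linarith
      then have "real 1 * E + 2 * (h x - real H) + a \<le> 5 * u\<^sup>2" by simp
      also have "5 * u\<^sup>2 \<le> (19/4 + 7/4 * sqrt 2) * u\<^sup>2"
        by (rule mult_right_mono) (use s2(1) in \<open>linarith, simp\<close>)
      finally show ?thesis .
    qed
    ultimately show ?case unfolding a_def[symmetric] unfolding r(6) by (meson order_trans)
  qed
qed

theorem theorem1:
  shows
    "(\<forall>c x x' :: real. \<forall>p t. c \<le> 7 \<and> x > 0 \<and> x powr (3/4) \<le> x' \<and> x' \<le> c * x \<longrightarrow>
        packing_waste (rectangle p t x x') \<le> ((15 + c) * sqrt 2 + 38) * x powr (5/8))
   \<and> (\<forall>x' \<theta> :: real \<Rightarrow> real.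
        x' \<sim>[at_top] (\<lambda>x. 2 * x powr (1/2)) \<and>
        (\<forall>\<^sub>F x in at_top. 0 < \<theta> x \<and> \<theta> x < sqrt 2 * x powr (-1/2)) \<longrightarrow>
        (\<forall>\<^sub>F x in at_top. \<forall>p.
           packing_waste (right_trapezoid p (x' x) x (\<theta> x))
             \<le> (19/2 + 7/2 * sqrt 2) * x powr (5/6)))
   \<and> (\<forall>h \<theta> :: real \<Rightarrow> real.
        h \<sim>[at_top] (\<lambda>x. 1/2 * x powr (1/2)) \<and>
        (\<forall>\<^sub>F x in at_top. 0 < \<theta> x \<and> \<theta> x < sqrt 2 * x powr (-1/2)) \<longrightarrow>
        (\<forall>\<^sub>F x in at_top. \<forall>p.
           packing_waste
             (right_trapezoid p (real_of_int \<lfloor>x powr (1/3) + sqrt 2 * x powr (1/6)\<rfloor>) (h x) (\<theta> x))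
             \<le> (19/4 + 7/4 * sqrt 2) * x powr (1/3)))
   \<and> (\<forall>x :: real. \<forall>p t. x > 0 \<longrightarrow>
        packing_waste (rectangle p t x x) \<le> (16 * sqrt 2 + 38) * x powr (5/8))"
  using rectangle_waste tall_trapezoid_waste short_trapezoid_waste square_waste by blast

end
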